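(* Let $T>0$ be a real number such that $\zeta(\sigma+iT)\neq 0$ for all $-1\le\sigma\le 2$. Then the number $N(T)$ of zeros of $\xi(s)=\frac{s}{2}(s-1)\pi^{-s/2}\Gamma\left(\frac{s}{2}\right)\zeta(s)$ in the rectangle $\{\sigma+it : -1\le\sigma\le 2,\ 0\le t\le T\}$, counted with multiplicity, is $$N(T)=\frac{\theta(T)+\arg\zeta\left(\frac12+iT\right)}{\pi}+1.$$
   Context: $\zeta$ is the Riemann zeta function and $\Gamma$ is the Gamma function; $\xi$ is an entire function, with the formula extended by continuity at removable singularities. The zeros of $\xi$ are precisely the non-trivial zeros of $\zeta$, so $N(T)$ is also the number of zeros of $\zeta$ in the rectangle. Arguments are defined by continuous variation: let $L_2$ be the path consisting of the line segment from $2$ to $2+iT$ followed by the line segment from $2+iT$ to $\frac12+iT$. Then $\theta(T)$ is the value at $s=\frac12+iT$ of $\arg\left[\pi^{-s/2}\Gamma\left(\frac{s}{2}\right)\right]$, and $\arg\zeta\left(\frac12+iT\right)$ is the value at $s=\frac12+iT$ of $\arg\zeta(s)$, each obtained by continuous variation along $L_2$ starting from the value $0$ at $s=2$. *)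

theory Defs
  imports "HOL-Complex_Analysis.Complex_Analysis"
begin

(* The Riemann zeta function: the analytic continuation of the Dirichlet series to the
   plane without 1.  The value at the pole is fixed to 0 so that the description is unique. *)
definition zeta :: "complex \<Rightarrow> complex" where
  "zeta = (THE f. f holomorphic_on - {1} \<and>
                  (\<forall>s. Re s > 1 \<longrightarrow> (\<lambda>n. 1 / of_nat (Suc n) powr s) sums f s) \<and>
                  f 1 = 0)"

(* The formula has removable singularities at 1 and at the poles 0, -2, -4, ... of Gamma (s / 2),
   where HOL assigns junk values; remove_sings replaces these by the limits. *)
definition xi :: "complex \<Rightarrow> complex" where
  "xi = remove_sings
     (\<lambda>s. s / 2 * (s - 1) * of_real pi powr (- s / 2) * Gamma (s / 2) * zeta s)"

definition zeros_in_rect :: "real \<Rightarrow> complex set" where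
  "zeros_in_rect T = {s. -1 \<le> Re s \<and> Re s \<le> 2 \<and> 0 \<le> Im s \<and> Im s \<le> T \<and> xi s = 0}"

definition N :: "real \<Rightarrow> int" where
  "N T = (\<Sum>s\<in>zeros_in_rect T. zorder xi s)"

(* The value at the end of the path g of the argument of f obtained by continuous variation
   along g, starting from the value a.  It is uniquely determined if f has no zeros on g,
   f is continuous there, and a is an argument of f at the start of g. *)
definition cont_arg :: "(complex \<Rightarrow> complex) \<Rightarrow> (real \<Rightarrow> complex) \<Rightarrow> real \<Rightarrow> real" where
  "cont_arg f g a =
     (THE v. \<exists>\<phi>. continuous_on {0..1} \<phi> \<and> \<phi> 0 = a \<and>
                 (\<forall>t\<in>{0..1}. is_Arg (f (g t)) (\<phi> t)) \<and> \<phi> 1 = v)"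

definition L2 :: "real \<Rightarrow> real \<Rightarrow> complex" where
  "L2 T = linepath 2 (Complex 2 T) +++ linepath (Complex 2 T) (Complex (1/2) T)"

definition theta :: "real \<Rightarrow> real" where
  "theta T = cont_arg (\<lambda>s. of_real pi powr (- s / 2) * Gamma (s / 2)) (L2 T) 0"

definition arg_zeta :: "real \<Rightarrow> real" where
  "arg_zeta T = cont_arg zeta (L2 T) 0"

end

theory Submission
  imports Defs "HOL-Probability.Characteristic_Functions" "HOL-Probability.Sinc_Integral"
begin

text \<open>
The proof is the argument principle for $\xi$ on the rectangle with corners $-1$ and $2 + iT$,
combined with the two symmetries $\xi(1 - s) = \xi(s)$ and $\xi(\bar s) = \overline{\xi(s)}$.
Together they say $\xi(1 - \bar s) = \overline{\xi(s)}$, so the reflection in the line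
$\mathrm{Re}\, s = 1/2$ conjugates $\xi$: along the part of the boundary to the left of that line
the argument of $\xi$ varies exactly as much as along the right-hand part, which is the path
\<^term>\<open>L2 T\<close>. On the lower side $\xi$ is real and has no zeros, so its argument does not vary there.
Hence $\pi N(T)$ is the variation of $\arg \xi$ along \<^term>\<open>L2 T\<close>
(\<open>zeros_by_half_contour\<close>). Writing $\xi(s)$ as the product of $s(s-1)/2$, $\pi^{-s/2}\Gamma(s/2)$ and
$\zeta(s)$, this variation is $\pi + \theta(T) + \arg\zeta(\frac12 + iT)$
(\<open>contour_integral_L2\<close>): the path leads the quadratic factor from the value $1$ to the negative number
$-(\frac14 + T^2)/2$ through the upper half plane.
The argument obtained by continuous variation along a path is turned into the imaginary part of
the contour integral of the logarithmic derivative in \<open>cont_arg_eq_contour_integral\<close>.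

What remains is to know $\zeta$: that its continuation exists, that $\xi$ is entire and symmetric,
and that $\xi$ has no zeros on the lower, left and right sides of the rectangle. The right side is
immediate from the Dirichlet series, and the left side is its mirror image; the rest comes from
Riemann's second proof of the functional equation. The Mellin transform of
$\omega(x) = \sum_{n \ge 1} e^{-\pi n^2 x}$ is $\pi^{-s/2}\Gamma(s/2)\zeta(s)$ for
$\mathrm{Re}\, s > 1$. The transformation $1 + 2\omega(1/x) = \sqrt x\,(1 + 2\omega(x))$
folds the integral over $(0, \infty)$ onto $(1, \infty)$ and yields
\[ \pi^{-s/2}\Gamma(s/2)\zeta(s) = G(s) + G(1 - s) + \frac{1}{s(s-1)} \]
with an entire function $G$ (\<open>theta_weight_mellin_split\<close>). The right-hand side is
symmetric under $s \mapsto 1 - s$ and defines the continuation. Moreover $G$ is positive and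
increasing on the real line, and $\zeta(2) = \pi^2/6$ shows that $G(2)$ is small; this excludes real
zeros of $\xi$ (\<open>xi_entire_real_pos\<close>).

The transformation of $\omega$ (\<open>theta_tail_inversion\<close>) is Poisson summation for a Gaussian,
proved here from the Dirichlet kernel: integrating a smooth function of rapid decay against the
kernel over the real line gives partial sums of its Fourier coefficients on one side, and on the
other side, interval by interval, converges to the sum of its values at the integers.
\<close>

section \<open>The Dirichlet kernel\<close>

text \<open>
Bessel's inequality: subtracting from \<open>g\<close> its projections onto the first \<open>n\<close> functions leaves a
remainder of nonnegative square integral, so the squares of the coefficients are summable. For the
sine functions below this is the Riemann--Lebesgue lemma.
\<close>

lemma bounded_orthogonal_coefficients_tendsto_0:
  fixes e :: "nat \<Rightarrow> 'a \<Rightarrow> real"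
  assumes "finite_measure M"
    and e_meas: "\<And>k. e k \<in> borel_measurable M" and e_bound: "\<And>k x. \<bar>e k x\<bar> \<le> C"
    and orth: "\<And>j k. (\<integral>x. e j x * e k x \<partial>M) = (if j = k then c else 0)" and c: "c > 0"
    and g_meas: "g \<in> borel_measurable M" and g_bound: "\<And>x. \<bar>g x\<bar> \<le> B"
  shows "(\<lambda>k. \<integral>x. g x * e k x \<partial>M) \<longlonglongrightarrow> 0"
proof -
  interpret finite_measure M by fact
  note [measurable] = e_meas g_meas
  define d where "d k = (\<integral>x. g x * e k x \<partial>M)" for k
  define r where "r n x = g x - (\<Sum>k<n. d k / c * e k x)" for n x
  have [measurable]: "r n \<in> borel_measurable M" for n
    unfolding r_def by measurable
  have r_bound: "\<exists>R. \<forall>x. \<bar>r n x\<bar> \<le> R" for n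
  proof (intro exI allI)
    fix x
    have "\<bar>r n x\<bar> \<le> \<bar>g x\<bar> + (\<Sum>k<n. \<bar>d k / c * e k x\<bar>)"
      unfolding r_def using sum_abs[of "\<lambda>k. d k / c * e k x" "{..<n}"] by linarith
    also have "\<dots> \<le> B + (\<Sum>k<n. \<bar>d k / c\<bar> * C)"
      by (intro add_mono sum_mono g_bound) (unfold abs_mult, intro mult_left_mono e_bound, simp)
    finally show "\<bar>r n x\<bar> \<le> B + (\<Sum>k<n. \<bar>d k / c\<bar> * C)" .
  qed
  have int: "integrable M (\<lambda>x. u x * v x)"
    if [measurable]: "u \<in> borel_measurable M" "v \<in> borel_measurable M"
      and bd: "\<exists>R. \<forall>x. \<bar>u x\<bar> \<le> R" "\<exists>R. \<forall>x. \<bar>v x\<bar> \<le> R" for u v :: "'a \<Rightarrow> real"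
  proof -
    obtain R1 R2 where R: "\<And>x. \<bar>u x\<bar> \<le> R1" "\<And>x. \<bar>v x\<bar> \<le> R2" using bd by auto
    have "norm (u x * v x) \<le> R1 * R2" for x
      using R[of x] by (auto simp: abs_mult intro!: mult_mono order_trans[OF abs_ge_zero])
    thus ?thesis by (intro integrable_const_bound[of _ "R1 * R2"]) auto
  qed
  have eb: "\<exists>R. \<forall>x. \<bar>e k x\<bar> \<le> R" for k using e_bound by blast
  have gb: "\<exists>R. \<forall>x. \<bar>g x\<bar> \<le> R" using g_bound by blast
  have re: "(\<integral>x. r n x * e n x \<partial>M) = d n" for n
  proof -
    have "(\<integral>x. r n x * e n x \<partial>M) = (\<integral>x. g x * e n x - (\<Sum>k<n. d k / c * (e k x * e n x)) \<partial>M)"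
      by (intro Bochner_Integration.integral_cong) (auto simp: r_def algebra_simps sum_distrib_left)
    also have "\<dots> = d n - (\<Sum>k<n. d k / c * (\<integral>x. e k x * e n x \<partial>M))"
      by (subst Bochner_Integration.integral_diff, (intro int eb gb Bochner_Integration.integrable_sum
            Bochner_Integration.integrable_mult_right; measurable)+,
          subst Bochner_Integration.integral_sum, (intro int eb Bochner_Integration.integrable_mult_right; measurable))
         (simp add: d_def)
    also have "\<dots> = d n" by (simp add: orth)
    finally show ?thesis .
  qed
  have pyth: "(\<integral>x. r n x * r n x \<partial>M) = (\<integral>x. g x * g x \<partial>M) - (\<Sum>k<n. (d k)\<^sup>2 / c)" for n
  proof (induction n)
    case 0
    show ?case by (simp add: r_def)
  next
    case (Suc n)
    have "(\<integral>x. r (Suc n) x * r (Suc n) x \<partial>M) =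
        (\<integral>x. r n x * r n x - 2 * (d n / c) * (r n x * e n x) + (d n / c)\<^sup>2 * (e n x * e n x) \<partial>M)"
      by (intro Bochner_Integration.integral_cong) (auto simp: r_def algebra_simps power2_eq_square)
    also have "\<dots> = (\<integral>x. r n x * r n x \<partial>M) - 2 * (d n / c) * d n + (d n / c)\<^sup>2 * c"
      using int[of "r n" "r n"] int[of "r n" "e n"] int[of "e n" "e n"] r_bound eb
      by (simp add: re orth)
    also have "\<dots> = (\<integral>x. r n x * r n x \<partial>M) - (d n)\<^sup>2 / c"
      using c by (simp add: field_simps power2_eq_square)
    finally show ?case using Suc by simp
  qed
  have "(\<Sum>k<n. (d k)\<^sup>2) \<le> c * (\<integral>x. g x * g x \<partial>M)" for n
  proof -
    have "0 \<le> (\<integral>x. r n x * r n x \<partial>M)" by (intro Bochner_Integration.integral_nonneg) auto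
    hence "(\<Sum>k<n. (d k)\<^sup>2) / c \<le> (\<integral>x. g x * g x \<partial>M)"
      by (simp add: pyth sum_divide_distrib)
    thus ?thesis using c by (simp add: field_simps)
  qed
  hence "summable (\<lambda>k. (d k)\<^sup>2)"
    by (intro summableI_nonneg_bounded) auto
  hence "(\<lambda>k. (d k)\<^sup>2) \<longlonglongrightarrow> 0" by (rule summable_LIMSEQ_zero)
  hence "(\<lambda>k. \<bar>d k\<bar>) \<longlonglongrightarrow> 0"
    using tendsto_real_sqrt[of "\<lambda>k. (d k)\<^sup>2" 0] by simp
  thus ?thesis unfolding d_def[symmetric] by (simp add: tendsto_rabs_zero_iff)
qed

abbreviation period_measure :: "real measure" where
  "period_measure \<equiv> restrict_space lborel {-(1/2)..<1/2}"

definition dirichlet_kernel :: "nat \<Rightarrow> real \<Rightarrow> real" where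
  "dirichlet_kernel K u = 1 + 2 * (\<Sum>k=1..K. cos (2 * pi * real k * u))"

lemma finite_period_measure: "finite_measure period_measure"
  by (rule finite_measureI) (simp add: emeasure_restrict_space space_restrict_space)

text \<open>
Multiplication by $\sin \pi u$ makes the sum telescope.
\<close>

lemma dirichlet_kernel_sin: "dirichlet_kernel K u * sin (pi * u) = sin ((2 * real K + 1) * pi * u)"
proof (induction K)
  case 0 show ?case by (simp add: dirichlet_kernel_def)
next
  case (Suc K)
  have "2 * cos (2 * pi * real (Suc K) * u) * sin (pi * u) =
      sin ((2 * real (Suc K) + 1) * pi * u) - sin ((2 * real K + 1) * pi * u)"
  proof -
    have "(2 * real (Suc K) + 1) * pi * u = 2 * pi * real (Suc K) * u + pi * u"
      "(2 * real K + 1) * pi * u = 2 * pi * real (Suc K) * u - pi * u"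
      by (auto simp: algebra_simps)
    thus ?thesis by (simp only: sin_add sin_diff)
  qed
  with Suc show ?case by (simp add: dirichlet_kernel_def algebra_simps)
qed

lemma dirichlet_kernel_shift: "dirichlet_kernel K (of_int c + u) = dirichlet_kernel K u"
proof -
  have "cos (2 * pi * real k * (of_int c + u)) = cos (2 * pi * real k * u)" for k
  proof -
    have "2 * pi * real k * (of_int c + u) = 2 * pi * real k * u + 2 * pi * of_int (int k * c)"
      by (simp add: algebra_simps)
    thus ?thesis by (simp only: cos_add sin_int_2pin cos_int_2pin)
  qed
  thus ?thesis by (simp add: dirichlet_kernel_def)
qed

lemma dirichlet_kernel_bound: "\<bar>dirichlet_kernel K u\<bar> \<le> 1 + 2 * real K"
proof -
  have "\<bar>\<Sum>k=1..K. cos (2 * pi * real k * u)\<bar> \<le> (\<Sum>k=1..K. \<bar>cos (2 * pi * real k * u)\<bar>)"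
    by (rule sum_abs)
  also have "\<dots> \<le> (\<Sum>k=1..K. 1)" by (intro sum_mono) simp
  finally show ?thesis unfolding dirichlet_kernel_def by simp
qed

lemma dirichlet_kernel_measurable [measurable]: "dirichlet_kernel K \<in> borel_measurable borel"
  unfolding dirichlet_kernel_def by measurable

lemma integral_period_measure:
  fixes f :: "real \<Rightarrow> real"
  assumes "continuous_on UNIV f"
  shows "(\<integral>u. f u \<partial>period_measure) = (LBINT u:{-(1/2)..1/2}. f u)"
proof -
  have [measurable]: "f \<in> borel_measurable borel"
    using assms by (rule borel_measurable_continuous_onI)
  have "(\<integral>u. f u \<partial>period_measure) = (\<integral>u. indicator {-(1/2)..<1/2} u *\<^sub>R f u \<partial>lborel)"
    by (subst integral_restrict_space) auto
  also have "\<dots> = (\<integral>u. indicator {-(1/2)..1/2} u *\<^sub>R f u \<partial>lborel)"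
  proof (intro integral_cong_AE)
    show "AE u in lborel. indicator {-(1/2)..<1/2} u *\<^sub>R f u = indicator {-(1/2)..1/2} u *\<^sub>R f u"
      using AE_lborel_singleton[of "1/2 :: real"]
      by eventually_elim (auto split: split_indicator)
  qed auto
  finally show ?thesis by (simp add: set_lebesgue_integral_def)
qed

lemma integral_one_period: "(\<integral>u. 1 \<partial>period_measure) = (1::real)"
  by (subst integral_period_measure) (auto simp: set_lebesgue_integral_def)

lemma integral_cos_period:
  assumes "k \<noteq> 0"
  shows "(\<integral>u. cos (2 * pi * of_int k * u) \<partial>period_measure) = 0"
proof -
  have "(LBINT u:{-(1/2)..1/2}. cos (2 * pi * of_int k * u)) =
     sin (2 * pi * of_int k * (1/2)) / (2 * pi * of_int k) - sin (2 * pi * of_int k * (-(1/2))) / (2 * pi * of_int k)"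
    unfolding set_lebesgue_integral_def
    by (rule integral_FTC_atLeastAtMost)
       (use assms in \<open>auto intro!: derivative_eq_intros continuous_intros simp flip: has_real_derivative_iff_has_vector_derivative\<close>)
  also have "\<dots> = 0"
    by (simp add: sin_npi_int mult.commute)
  finally show ?thesis
    by (subst integral_period_measure) (auto intro!: continuous_intros)
qed

lemma integrable_period_bounded:
  fixes f :: "real \<Rightarrow> real"
  assumes "f \<in> borel_measurable borel" "\<And>u. \<bar>f u\<bar> \<le> B"
  shows "integrable period_measure f"
  using assms finite_period_measure
  by (intro finite_measure.integrable_const_bound[of _ _ B]) (auto simp: measurable_restrict_space1)

lemma integral_dirichlet_kernel: "(\<integral>u. dirichlet_kernel K u \<partial>period_measure) = 1"
proof -
  have int: "integrable period_measure (\<lambda>u. cos (2 * pi * real k * u))" for k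
    by (rule integrable_period_bounded[of _ 1]) auto
  have "(\<integral>u. dirichlet_kernel K u \<partial>period_measure) = (\<integral>u. 1 \<partial>period_measure) + 
      2 * (\<Sum>k=1..K. \<integral>u. cos (2 * pi * of_int (int k) * u) \<partial>period_measure)"
    unfolding dirichlet_kernel_def
    by (subst Bochner_Integration.integral_add)
       (auto intro!: int Bochner_Integration.integral_sum Bochner_Integration.integrable_sum
          integrable_period_bounded[of "\<lambda>_. 1" 1])
  also have "(\<Sum>k=1..K. \<integral>u. cos (2 * pi * of_int (int k) * u) \<partial>period_measure) = 0"
    by (intro sum.neutral ballI integral_cos_period) auto
  finally show ?thesis using integral_one_period by simp
qed

text \<open>
The functions $\sin((2k+1)\pi u)$ change sign under $u \mapsto u + 1$, but products of two of them
have period $1$, so they are still orthogonal over a period.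
\<close>

lemma integral_sin_odd_period:
  "(\<integral>u. sin ((2 * real j + 1) * pi * u) * sin ((2 * real k + 1) * pi * u) \<partial>period_measure) =
     (if j = k then 1 / 2 else 0)"
proof -
  have "(\<integral>u. sin ((2 * real j + 1) * pi * u) * sin ((2 * real k + 1) * pi * u) \<partial>period_measure) =
     (\<integral>u. (cos (2 * pi * of_int (int j - int k) * u) - cos (2 * pi * of_int (int j + int k + 1) * u)) / 2 \<partial>period_measure)"
    by (intro Bochner_Integration.integral_cong refl)
       (simp add: sin_times_sin algebra_simps)
  also have "\<dots> = ((\<integral>u. cos (2 * pi * of_int (int j - int k) * u) \<partial>period_measure) 
       - (\<integral>u. cos (2 * pi * of_int (int j + int k + 1) * u) \<partial>period_measure)) / 2"
    by (simp, subst Bochner_Integration.integral_diff)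
       (auto intro!: integrable_period_bounded[of _ 1])
  also have "\<dots> = (if j = k then 1 / 2 else 0)"
    using integral_cos_period[of "int j - int k"] integral_cos_period[of "int j + int k + 1"] 
       integral_one_period by auto
  finally show ?thesis .
qed

text \<open>
A weak form of Jordan's inequality; it bounds the quotient of $\varphi(c+u) - \varphi(c)$ by
$\sin \pi u$ near $u = 0$.
\<close>

lemma abs_sin_pi_ge:
  assumes "\<bar>u\<bar> \<le> 1 / 2"
  shows "\<bar>sin (pi * u)\<bar> \<ge> \<bar>u\<bar>"
proof -
  have "\<bar>sin (pi * u) - (\<Sum>m<3. sin_coeff m * (pi * u) ^ m)\<bar> \<le> inverse (fact 3) * \<bar>pi * u\<bar> ^ 3"
    by (rule Maclaurin_sin_bound)
  also have "(\<Sum>m<3. sin_coeff m * (pi * u) ^ m) = pi * u"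
    by (simp add: eval_nat_numeral sin_coeff_def)
  also have "inverse (fact 3) * \<bar>pi * u\<bar> ^ 3 = \<bar>pi * u\<bar> * ((pi * u)\<^sup>2 / 6)"
    by (simp add: fact_numeral power3_eq_cube power2_eq_square abs_mult)
  finally have 1: "\<bar>sin (pi * u) - pi * u\<bar> \<le> \<bar>pi * u\<bar> * ((pi * u)\<^sup>2 / 6)" .
  have "pi \<le> 3.2" using pi_approx by simp
  hence "pi * \<bar>u\<bar> \<le> 3.2 * (1/2)" using assms by (intro mult_mono) auto
  hence "(pi * \<bar>u\<bar>)\<^sup>2 \<le> 1.6\<^sup>2" by (intro power_mono) auto
  moreover have "(pi * \<bar>u\<bar>)\<^sup>2 = (pi * u)\<^sup>2" by (simp only: power_mult_distrib power2_abs)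
  ultimately have "(pi * u)\<^sup>2 / 6 \<le> 1 / 2" by (simp add: power_divide)
  hence "\<bar>pi * u\<bar> * ((pi * u)\<^sup>2 / 6) \<le> \<bar>pi * u\<bar> * (1 / 2)" by (intro mult_left_mono) auto
  with 1 have "\<bar>sin (pi * u)\<bar> \<ge> \<bar>pi * u\<bar> / 2" by linarith
  moreover have "\<bar>pi * u\<bar> / 2 \<ge> \<bar>u\<bar>"
    using pi_gt3 mult_right_mono[of 2 pi "\<bar>u\<bar>"] by (simp add: abs_mult)
  ultimately show ?thesis by linarith
qed

text \<open>
Since the kernel has integral $1$, the difference of the two sides is the integral of
$\frac{\varphi(c+u) - \varphi(c)}{\sin \pi u}$ against $\sin((2K+1)\pi u)$. The quotient is bounded by
the mean value theorem and \<open>abs_sin_pi_ge\<close>, so Bessel's inequality makes the difference tend to $0$. The second claim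
bounds it uniformly in \<open>K\<close>, which allows summation over all integers \<open>c\<close>.
\<close>

lemma dirichlet_integral:
  fixes \<phi> \<phi>' :: "real \<Rightarrow> real"
  assumes deriv: "\<And>v. (\<phi> has_real_derivative \<phi>' v) (at v)"
    and bound: "\<And>u. \<bar>u\<bar> \<le> 1 / 2 \<Longrightarrow> \<bar>\<phi>' (c + u)\<bar> \<le> L"
  shows "(\<lambda>K. \<integral>u. \<phi> (c + u) * dirichlet_kernel K u \<partial>period_measure) \<longlonglongrightarrow> \<phi> c" (is ?lim)
    and "\<bar>(\<integral>u. \<phi> (c + u) * dirichlet_kernel K u \<partial>period_measure) - \<phi> c\<bar> \<le> L"
proof -
  have cont: "continuous_on UNIV \<phi>"
    using deriv by (meson DERIV_isCont continuous_at_imp_continuous_on)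
  note [measurable] = borel_measurable_continuous_onI[OF cont]
  have L: "L \<ge> 0" using bound[of 0] by auto
  \<comment> \<open>At \<open>u = 0\<close> the quotient is \<open>0\<close> by division by zero, which respects the bound \<open>L\<close>.\<close>
  define g where "g u = (if \<bar>u\<bar> \<le> 1 / 2 then (\<phi> (c + u) - \<phi> c) / sin (pi * u) else 0)" for u
  have [measurable]: "g \<in> borel_measurable borel" unfolding g_def by measurable
  have diff: "\<bar>\<phi> (c + u) - \<phi> c\<bar> \<le> L * \<bar>u\<bar>" if "\<bar>u\<bar> \<le> 1 / 2" for u
  proof -
    have "norm (\<phi> (c + u) - \<phi> c) \<le> L * norm ((c + u) - c)"
    proof (rule field_differentiable_bound[of "cball c (1/2)"])
      fix z assume "z \<in> cball c (1/2)"
      thus "norm (\<phi>' z) \<le> L" using bound[of "z - c"] by (simp add: dist_real_def abs_minus_commute)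
    qed (use that deriv in \<open>auto simp: dist_real_def intro: has_field_derivative_at_within\<close>)
    thus ?thesis by simp
  qed
  have g_bound: "\<bar>g u\<bar> \<le> L" for u
  proof (cases "\<bar>u\<bar> \<le> 1 / 2 \<and> u \<noteq> 0")
    case True
    hence *: "\<bar>sin (pi * u)\<bar> \<ge> \<bar>u\<bar>" "\<bar>u\<bar> > 0" using abs_sin_pi_ge by auto
    have "\<bar>\<phi> (c + u) - \<phi> c\<bar> \<le> L * \<bar>sin (pi * u)\<bar>"
      using diff[of u] True * L by (meson mult_left_mono order_trans)
    thus ?thesis using * True unfolding g_def by (auto simp: abs_divide intro!: pos_divide_le_eq[THEN iffD2])
  qed (use L in \<open>auto simp: g_def\<close>)
  have gs: "\<bar>g u * sin y\<bar> \<le> L" for u y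
    using mult_mono[OF g_bound abs_sin_le_one L abs_ge_zero] by (simp add: abs_mult)
  have split: "(\<integral>u. \<phi> (c + u) * dirichlet_kernel K u \<partial>period_measure) =
      \<phi> c + (\<integral>u. g u * sin ((2 * real K + 1) * pi * u) \<partial>period_measure)" for K
  proof -
    have "(\<integral>u. \<phi> (c + u) * dirichlet_kernel K u \<partial>period_measure) =
       (\<integral>u. \<phi> c * dirichlet_kernel K u + g u * sin ((2 * real K + 1) * pi * u) \<partial>period_measure)"
    proof (intro Bochner_Integration.integral_cong refl)
      fix u :: real assume "u \<in> space period_measure"
      hence u: "\<bar>u\<bar> \<le> 1 / 2" by (auto simp: space_restrict_space)
      show "\<phi> (c + u) * dirichlet_kernel K u = \<phi> c * dirichlet_kernel K u + g u * sin ((2 * real K + 1) * pi * u)"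
      proof (cases "u = 0")
        case False
        hence "sin (pi * u) \<noteq> 0" using abs_sin_pi_ge[OF u] by auto
        thus ?thesis using u unfolding dirichlet_kernel_sin[symmetric]
          by (simp add: g_def field_simps)
      qed (simp add: g_def)
    qed
    also have "\<dots> = \<phi> c * (\<integral>u. dirichlet_kernel K u \<partial>period_measure) + 
        (\<integral>u. g u * sin ((2 * real K + 1) * pi * u) \<partial>period_measure)"
    proof (subst Bochner_Integration.integral_add)
      show "integrable period_measure (\<lambda>u. \<phi> c * dirichlet_kernel K u)"
        by (rule integrable_period_bounded[of _ "\<bar>\<phi> c\<bar> * (1 + 2 * real K)"])
           (auto simp: abs_mult intro!: mult_left_mono dirichlet_kernel_bound)
      show "integrable period_measure (\<lambda>u. g u * sin ((2 * real K + 1) * pi * u))"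
        by (rule integrable_period_bounded[OF _ gs]) measurable
    qed simp
    finally show ?thesis by (simp add: integral_dirichlet_kernel)
  qed
  have "(\<lambda>K. \<integral>u. g u * sin ((2 * real K + 1) * pi * u) \<partial>period_measure) \<longlonglongrightarrow> 0"
    by (rule bounded_orthogonal_coefficients_tendsto_0[where C = 1 and B = L and c = "1/2"])
       (auto simp: finite_period_measure g_bound integral_sin_odd_period intro!: measurable_restrict_space1)
  from tendsto_add[OF tendsto_const[of "\<phi> c"] this] show ?lim by (simp add: split)
  have "\<bar>\<integral>u. g u * sin ((2 * real K + 1) * pi * u) \<partial>period_measure\<bar> \<le> (\<integral>u. L * 1 \<partial>period_measure)"
  proof (rule order_trans[OF integral_abs_bound], rule integral_mono)
    show "integrable period_measure (\<lambda>u. \<bar>g u * sin ((2 * real K + 1) * pi * u)\<bar>)"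
      by (rule integrable_period_bounded[of _ L]) (auto intro!: gs)
    show "integrable period_measure (\<lambda>u. L * 1)"
      by (rule integrable_period_bounded[of _ "L"]) (auto simp: L)
  qed (simp add: gs)
  also have "\<dots> = L" using integral_one_period 
    by (simp only: Bochner_Integration.integral_mult_right_zero)
  finally show "\<bar>(\<integral>u. \<phi> (c + u) * dirichlet_kernel K u \<partial>period_measure) - \<phi> c\<bar> \<le> L"
    by (simp add: split)
qed

section \<open>Poisson summation and the theta function\<close>

text \<open>
Poisson summation in integrated form: the left-hand integrals are the symmetric partial sums of the
Fourier transform of $\varphi$ at the integers. The real line is cut into unit intervals around the
integers; periodicity of the kernel moves each of them to the origin, where \<open>dirichlet_integral\<close>
gives the limit $\varphi(c)$ and a bound of order $1/(1 + c^2)$. Tannery's theorem then exchanges the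
limit with the sum over the intervals.
\<close>

lemma poisson_summation_dirichlet:
  fixes \<phi> \<phi>' :: "real \<Rightarrow> real"
  assumes deriv: "\<And>v. (\<phi> has_real_derivative \<phi>' v) (at v)"
    and int: "integrable lborel \<phi>"
    and bound: "\<And>v. \<bar>\<phi> v\<bar> \<le> C / (1 + v\<^sup>2)" and bound': "\<And>v. \<bar>\<phi>' v\<bar> \<le> C / (1 + v\<^sup>2)"
    and even: "\<And>v. \<phi> (- v) = \<phi> v"
  shows "(\<lambda>K. \<integral>v. \<phi> v * dirichlet_kernel K v \<partial>lborel) \<longlonglongrightarrow> \<phi> 0 + 2 * (\<Sum>n. \<phi> (real (Suc n)))"
proof -
  have cont: "continuous_on UNIV \<phi>"
    using deriv by (meson DERIV_isCont continuous_at_imp_continuous_on)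
  note [measurable] = borel_measurable_continuous_onI[OF cont]
  have C: "C \<ge> 0" using bound[of 0] by auto
  define I where "I c = {real_of_int c - 1/2..<real_of_int c + 1/2}" for c
  have I_iff: "x \<in> I c \<longleftrightarrow> \<lfloor>x + 1/2\<rfloor> = c" for x c
    unfolding I_def by (auto simp: floor_eq_iff)
  define J where "J c K = (\<integral>u. \<phi> (of_int c + u) * dirichlet_kernel K u \<partial>period_measure)" for c K
  \<comment> \<open>The intervals around \<open>n\<close> and \<open>-n\<close> are paired, so that the pieces are indexed by natural numbers.\<close>
  define A where "A n = I (int n) \<union> I (- int n)" for n
  define a where "a n K = (if n = 0 then J 0 K else J (int n) K + J (- int n) K)" for n K
  define b where "b n = (if n = 0 then \<phi> 0 else 2 * \<phi> (real n))" for n :: nat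
  have [measurable]: "I c \<in> sets borel" for c unfolding I_def by measurable
  have intD: "integrable lborel (\<lambda>v. \<phi> v * dirichlet_kernel K v)" for K
  proof (rule Bochner_Integration.integrable_bound)
    show "integrable lborel (\<lambda>v. (1 + 2 * real K) * \<phi> v)" using int by simp
    show "AE v in lborel. norm (\<phi> v * dirichlet_kernel K v) \<le> norm ((1 + 2 * real K) * \<phi> v)"
      using dirichlet_kernel_bound[of K] by (auto simp: abs_mult mult.commute intro!: mult_left_mono)
  qed measurable
  hence intI: "set_integrable lborel B (\<lambda>v. \<phi> v * dirichlet_kernel K v)" if "B \<in> sets borel" for B K
    unfolding set_integrable_def by (rule integrable_mult_indicator[rotated]) (use that in auto)
  have JI: "(LBINT v:I c. \<phi> v * dirichlet_kernel K v) = J c K" for c K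
  proof -
    have "(LBINT v:I c. \<phi> v * dirichlet_kernel K v) =
       (\<integral>u. indicator (I c) (of_int c + u) * (\<phi> (of_int c + u) * dirichlet_kernel K (of_int c + u)) \<partial>lborel)"
      unfolding set_lebesgue_integral_def
      by (subst lborel_integral_real_affine[where c = 1 and t = "of_int c"]) auto
    also have "\<dots> = (\<integral>u. indicator {-(1/2)..<1/2} u *\<^sub>R (\<phi> (of_int c + u) * dirichlet_kernel K u) \<partial>lborel)"
      by (intro Bochner_Integration.integral_cong) (auto simp: I_def dirichlet_kernel_shift split: split_indicator)
    finally show ?thesis by (simp add: J_def integral_restrict_space)
  qed
  have eq: "(\<integral>v. \<phi> v * dirichlet_kernel K v \<partial>lborel) = (\<Sum>n. a n K)" for K
  proof -
    have U: "(\<Union>n. A n) = UNIV"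
    proof safe
      fix x :: real
      have "x \<in> A (nat \<bar>\<lfloor>x + 1/2\<rfloor>\<bar>)" by (auto simp: A_def I_iff)
      thus "x \<in> (\<Union>n. A n)" by blast
    qed auto
    have An: "(LBINT v:A n. \<phi> v * dirichlet_kernel K v) = a n K" for n
    proof (cases "n = 0")
      case False
      hence "I (int n) \<inter> I (- int n) = {}" by (auto simp: I_iff)
      hence "(LBINT v:A n. \<phi> v * dirichlet_kernel K v) =
          (LBINT v:I (int n). \<phi> v * dirichlet_kernel K v) + (LBINT v:I (-int n). \<phi> v * dirichlet_kernel K v)"
        unfolding A_def by (intro set_integral_Un intI) auto
      thus ?thesis using False by (simp add: JI a_def)
    qed (simp add: A_def a_def JI)
    have "(LBINT v:(\<Union>n. A n). \<phi> v * dirichlet_kernel K v) = (\<Sum>n. LBINT v:A n. \<phi> v * dirichlet_kernel K v)"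
      by (rule lebesgue_integral_countable_add) (auto simp: A_def I_iff intro!: intI)
    also have "\<dots> = (\<Sum>n. a n K)" unfolding An ..
    finally show ?thesis by (simp add: U set_lebesgue_integral_def)
  qed
  have L: "\<bar>\<phi>' (of_int c + u)\<bar> \<le> 4 * C / (1 + (of_int c)\<^sup>2)" if "\<bar>u\<bar> \<le> 1 / 2" for c u
  proof -
    \<comment> \<open>Passing from \<open>c\<close> to \<open>c + u\<close> costs at most a factor 4 in the weight \<open>1 + c\<^sup>2\<close>.\<close>
    have "u\<^sup>2 \<le> 1 / 4" using power_mono[OF that, of 2] by (simp add: power2_eq_square)
    moreover have "0 \<le> (of_int c + 2 * u)\<^sup>2" "0 \<le> (real_of_int c)\<^sup>2" by simp_all
    moreover have "4 * (1 + (of_int c + u)\<^sup>2) - (1 + (of_int c)\<^sup>2) =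
        2 * (of_int c + 2 * u)\<^sup>2 + (of_int c)\<^sup>2 + (3 - 4 * u\<^sup>2)"
      by (simp add: power2_eq_square algebra_simps)
    ultimately have "1 + (of_int c)\<^sup>2 \<le> 4 * (1 + (of_int c + u)\<^sup>2)"
      by linarith
    hence "C * (1 + (of_int c)\<^sup>2) \<le> C * (4 * (1 + (of_int c + u)\<^sup>2))" using C by (intro mult_left_mono)
    hence "C / (1 + (of_int c + u)\<^sup>2) \<le> 4 * C / (1 + (of_int c)\<^sup>2)"
      by (simp add: divide_le_eq pos_le_divide_eq add_pos_nonneg mult_ac)
    with bound'[of "of_int c + u"] show ?thesis by linarith
  qed
  have J_lim: "(\<lambda>K. J c K) \<longlonglongrightarrow> \<phi> (of_int c)" for c
    unfolding J_def by (rule dirichlet_integral(1)[OF deriv L])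
  have J_bound: "\<bar>J c K\<bar> \<le> 5 * C / (1 + (of_int c)\<^sup>2)" for c K
  proof -
    have "\<bar>J c K - \<phi> (of_int c)\<bar> \<le> 4 * C / (1 + (of_int c)\<^sup>2)"
      unfolding J_def by (rule dirichlet_integral(2)[OF deriv L])
    moreover have "5 * C / (1 + (of_int c)\<^sup>2) = 4 * C / (1 + (of_int c)\<^sup>2) + C / (1 + (of_int c)\<^sup>2)"
      by (simp add: add_divide_distrib[symmetric])
    ultimately show ?thesis using bound[of "of_int c"] by linarith
  qed
  have lim: "(\<lambda>K. a n K) \<longlonglongrightarrow> b n" for n
    using tendsto_add[OF J_lim[of "int n"] J_lim[of "- int n"]] J_lim[of 0]
    unfolding a_def b_def by (cases "n = 0") (auto simp: even)
  have a_bound: "\<bar>a n K\<bar> \<le> 20 * C * (1 / (real (Suc n))\<^sup>2)" for n K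
  proof -
    have "\<bar>a n K\<bar> \<le> 10 * C / (1 + (real n)\<^sup>2)"
      using J_bound[of "int n" K] J_bound[of "- int n" K] J_bound[of 0 K] C
      unfolding a_def by (auto simp: add_divide_distrib[symmetric])
    also have "\<dots> \<le> 20 * C * (1 / (real (Suc n))\<^sup>2)"
    proof -
      have "0 \<le> (real n - 1)\<^sup>2" by simp
      hence "(real (Suc n))\<^sup>2 \<le> 2 * (1 + (real n)\<^sup>2)" by (simp add: power2_eq_square algebra_simps)
      hence "C * (real (Suc n))\<^sup>2 \<le> C * (2 * (1 + (real n)\<^sup>2))" using C by (intro mult_left_mono)
      hence "10 * (C * (real (Suc n))\<^sup>2) \<le> 10 * (C * (2 * (1 + (real n)\<^sup>2)))" by linarith
      thus ?thesis by (simp add: divide_le_eq pos_le_divide_eq add_pos_nonneg algebra_simps)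
    qed
    finally show ?thesis .
  qed
  have sm: "summable (\<lambda>n. 20 * C * (1 / (real (Suc n))\<^sup>2))"
    using sums_summable[OF inverse_squares_sums] by (intro summable_mult) simp
  have tan: "summable (\<lambda>n. norm (b n)) \<and> (\<lambda>K. \<Sum>n. a n K) \<longlonglongrightarrow> (\<Sum>n. b n)"
    using tannerys_theorem[of a b sequentially "\<lambda>n. 20 * C * (1 / (real (Suc n))\<^sup>2)"] lim sm a_bound
    by (auto simp: case_prod_unfold)
  hence b: "summable b" using summable_norm_cancel by blast
  have "(\<Sum>n. b n) = (\<Sum>n. b (Suc n)) + b 0" using suminf_split_head[OF b] by simp
  also have "(\<Sum>n. b (Suc n)) = 2 * (\<Sum>n. \<phi> (real (Suc n)))"
  proof -
    have "summable (\<lambda>n. 2 * \<phi> (real (Suc n)))"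
      using summable_Suc_iff[THEN iffD2, OF b] by (simp add: b_def)
    hence "summable (\<lambda>n. \<phi> (real (Suc n)))" by (rule summable_mult_D) simp
    thus ?thesis by (subst suminf_mult[symmetric]) (auto simp: b_def)
  qed
  finally show ?thesis using tan by (simp add: eq b_def add.commute)
qed

lemma gaussian_integrable:
  assumes "a > 0"
  shows "integrable lborel (\<lambda>v. exp (- pi * a * v\<^sup>2))"
proof -
  have "integrable lborel (\<lambda>v. sqrt (2 * pi * (sqrt (1 / (2 * pi * a)))\<^sup>2) * normal_density 0 (sqrt (1 / (2 * pi * a))) v)"
    using assms by (intro Bochner_Integration.integrable_mult_right integrable_normal_density) auto
  also have "(\<lambda>v. sqrt (2 * pi * (sqrt (1 / (2 * pi * a)))\<^sup>2) * normal_density 0 (sqrt (1 / (2 * pi * a))) v) =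
     (\<lambda>v. exp (- pi * a * v\<^sup>2))"
    using assms by (auto simp: normal_density_def fun_eq_iff field_simps)
  finally show ?thesis .
qed

text \<open>
This is the characteristic function of the normal distribution, rescaled.
\<close>

lemma gaussian_fourier_transform:
  fixes a k :: real
  assumes a: "a > 0"
  shows "(\<integral>v. exp (- pi * a * v\<^sup>2) * cos (2 * pi * k * v) \<partial>lborel) = exp (- pi * k\<^sup>2 / a) / sqrt a"
proof -
  define c where "c = sqrt (2 * pi * a)"
  define t where "t = 2 * pi * k / c"
  have c: "c > 0" "c\<^sup>2 = 2 * pi * a" "c = sqrt (2 * pi) * sqrt a"
    using a unfolding c_def by (simp, simp add: real_sqrt_pow2, simp only: real_sqrt_mult)
  have intd: "integrable lborel (\<lambda>x. std_normal_density x *\<^sub>R iexp (t * x))"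
    by (rule Bochner_Integration.integrable_bound[of _ std_normal_density])
       (auto intro!: integrable_normal_density)
  have "complex_of_real (exp (- (t\<^sup>2) / 2)) = (CLINT x|std_normal_distribution. iexp (t * x))"
    using char_std_normal_distribution by (metis char_def)
  also have "\<dots> = (CLINT x|lborel. std_normal_density x *\<^sub>R iexp (t * x))"
    by (subst integral_density) auto
  finally have "exp (- (t\<^sup>2) / 2) = Re (CLINT x|lborel. std_normal_density x *\<^sub>R iexp (t * x))"
    by (metis Re_complex_of_real)
  also have "\<dots> = (\<integral>x. Re (std_normal_density x *\<^sub>R iexp (t * x)) \<partial>lborel)"
    by (rule integral_Re[symmetric, OF intd])
  also have "\<dots> = (\<integral>x. std_normal_density x * cos (t * x) \<partial>lborel)"
    by (simp add: Re_exp)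
  also have "\<dots> = c * (\<integral>v. std_normal_density (0 + c * v) * cos (t * (0 + c * v)) \<partial>lborel)"
    using c by (subst lborel_integral_real_affine[where c = c and t = 0]) auto
  also have "(\<integral>v. std_normal_density (0 + c * v) * cos (t * (0 + c * v)) \<partial>lborel) = 
      (\<integral>v. (exp (- pi * a * v\<^sup>2) * cos (2 * pi * k * v)) / sqrt (2 * pi) \<partial>lborel)"
    using c(1) by (intro Bochner_Integration.integral_cong refl)
       (simp add: std_normal_density_def power_mult_distrib c(2) t_def mult_ac)
  also have "c * \<dots> = sqrt a * (\<integral>v. exp (- pi * a * v\<^sup>2) * cos (2 * pi * k * v) \<partial>lborel)"
    by (simp add: c(3))
  finally have "(\<integral>v. exp (- pi * a * v\<^sup>2) * cos (2 * pi * k * v) \<partial>lborel) = exp (- (t\<^sup>2) / 2) / sqrt a"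
    using a by (simp add: field_simps)
  also have "- (t\<^sup>2) / 2 = - pi * k\<^sup>2 / a"
    using a unfolding t_def power_divide c(2) by (simp add: power2_eq_square field_simps)
  finally show ?thesis .
qed

text \<open>
Jacobi's theta function is $1 + 2\omega(x)$ for the function $\omega$ defined here.
\<close>

definition theta_tail :: "real \<Rightarrow> real" where
  "theta_tail x = (\<Sum>n. exp (- pi * (real (Suc n))\<^sup>2 * x))"

lemma summable_theta_tail:
  assumes "x > 0"
  shows "summable (\<lambda>n. exp (- pi * (real (Suc n))\<^sup>2 * x))"
proof (rule summable_comparison_test_ev)
  show "summable (\<lambda>n. exp (- pi * x) ^ n)"
    using assms by (intro summable_geometric) auto
  have "norm (exp (- pi * (real (Suc n))\<^sup>2 * x)) \<le> exp (- pi * x) ^ n" for n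
  proof -
    have "real n \<le> (real (Suc n))\<^sup>2" by (simp add: power2_eq_square algebra_simps)
    hence "real n * (pi * x) \<le> (real (Suc n))\<^sup>2 * (pi * x)" using assms by (intro mult_right_mono) auto
    thus ?thesis by (simp add: exp_of_nat_mult[symmetric] algebra_simps)
  qed
  thus "\<forall>\<^sub>F n in sequentially. norm (exp (- pi * (real (Suc n))\<^sup>2 * x)) \<le> exp (- pi * x) ^ n" by simp
qed

text \<open>
Poisson summation for the Gaussian $e^{-\pi a v^2}$, whose Fourier transform is
$a^{-1/2} e^{-\pi k^2/a}$.
\<close>

theorem theta_tail_inversion:
  assumes a: "a > 0"
  shows "1 + 2 * theta_tail (1 / a) = sqrt a * (1 + 2 * theta_tail a)"
proof -
  define \<phi> where "\<phi> v = exp (- pi * a * v\<^sup>2)" for v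
  define \<phi>' where "\<phi>' v = - (2 * pi * a * v) * exp (- pi * a * v\<^sup>2)" for v
  \<comment> \<open>Chosen so that \<open>1 + v\<^sup>2 \<le> m * exp (pi * a * v\<^sup>2 / 2)\<close>; the square of this gives the required decay.\<close>
  define m where "m = max 1 (2 / (pi * a))"
  define C where "C = m\<^sup>2 * (1 + 2 * pi * a)"
  have m: "m \<ge> 1" "pi * a * m \<ge> 2"
    using a by (auto simp: m_def max_def field_simps)
  have main: "(1 + v\<^sup>2)\<^sup>2 * \<phi> v \<le> m\<^sup>2" for v
  proof -
    have "1 + v\<^sup>2 \<le> m * (1 + pi * a * v\<^sup>2 / 2)"
      using m mult_right_mono[OF m(2), of "v\<^sup>2"] by (simp add: algebra_simps)
    also have "\<dots> \<le> m * exp (pi * a * v\<^sup>2 / 2)"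
      using m exp_ge_add_one_self[of "pi * a * v\<^sup>2 / 2"] by (intro mult_left_mono) auto
    finally have "(1 + v\<^sup>2)\<^sup>2 \<le> (m * exp (pi * a * v\<^sup>2 / 2))\<^sup>2"
      by (intro power_mono) auto
    also have "\<dots> = m\<^sup>2 * exp (pi * a * v\<^sup>2)"
      by (simp add: power_mult_distrib exp_double[symmetric])
    finally show ?thesis by (simp add: \<phi>_def exp_minus field_simps)
  qed
  have b0: "\<bar>\<phi> v\<bar> \<le> m\<^sup>2 / (1 + v\<^sup>2)" and b1: "\<bar>v * \<phi> v\<bar> \<le> m\<^sup>2 / (1 + v\<^sup>2)" for v
  proof -
    have pos: "1 + v\<^sup>2 > 0" by (simp add: add_pos_nonneg)
    have v: "\<bar>v\<bar> \<le> 1 + v\<^sup>2"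
    proof -
      have "0 \<le> (\<bar>v\<bar> - 1 / 2)\<^sup>2" by simp
      thus ?thesis by (simp add: power2_eq_square algebra_simps)
    qed
    have "\<phi> v * (1 + v\<^sup>2) \<le> (1 + v\<^sup>2)\<^sup>2 * \<phi> v"
      using pos by (simp add: \<phi>_def power2_eq_square)
    with main[of v] have "\<phi> v * (1 + v\<^sup>2) \<le> m\<^sup>2" by linarith
    thus "\<bar>\<phi> v\<bar> \<le> m\<^sup>2 / (1 + v\<^sup>2)" using pos by (simp add: pos_le_divide_eq \<phi>_def)
    have "\<bar>v * \<phi> v\<bar> * (1 + v\<^sup>2) \<le> (1 + v\<^sup>2) * \<phi> v * (1 + v\<^sup>2)"
      using v pos by (simp add: \<phi>_def abs_mult mult_right_mono)
    also have "\<dots> = (1 + v\<^sup>2)\<^sup>2 * \<phi> v" by (simp add: power2_eq_square mult_ac)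
    finally show "\<bar>v * \<phi> v\<bar> \<le> m\<^sup>2 / (1 + v\<^sup>2)" using pos main[of v] by (simp add: pos_le_divide_eq)
  qed
  have "(\<lambda>K. \<integral>v. \<phi> v * dirichlet_kernel K v \<partial>lborel) \<longlonglongrightarrow> \<phi> 0 + 2 * (\<Sum>n. \<phi> (real (Suc n)))"
  proof (rule poisson_summation_dirichlet)
    show "(\<phi> has_real_derivative \<phi>' v) (at v)" for v
      unfolding \<phi>_def \<phi>'_def by (auto intro!: derivative_eq_intros)
    show "integrable lborel \<phi>" unfolding \<phi>_def by (rule gaussian_integrable[OF a])
    have "m\<^sup>2 * (1 + 2 * pi * a) / (1 + v\<^sup>2) = m\<^sup>2 / (1 + v\<^sup>2) + 2 * pi * a * (m\<^sup>2 / (1 + v\<^sup>2))" for v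
      by (simp add: field_simps add_divide_distrib)
    hence C: "C / (1 + v\<^sup>2) = m\<^sup>2 / (1 + v\<^sup>2) + 2 * pi * a * (m\<^sup>2 / (1 + v\<^sup>2))" for v
      by (simp add: C_def)
    show "\<bar>\<phi> v\<bar> \<le> C / (1 + v\<^sup>2)" for v
      using b0[of v] a unfolding C by (smt (verit) divide_nonneg_nonneg mult_nonneg_nonneg pi_ge_zero zero_le_power2)
    have "\<bar>\<phi>' v\<bar> = 2 * pi * a * \<bar>v * \<phi> v\<bar>" for v
      using a by (simp add: \<phi>_def \<phi>'_def abs_mult)
    moreover have "2 * pi * a * \<bar>v * \<phi> v\<bar> \<le> 2 * pi * a * (m\<^sup>2 / (1 + v\<^sup>2))" for v
      using a by (intro mult_left_mono b1) auto
    ultimately show "\<bar>\<phi>' v\<bar> \<le> C / (1 + v\<^sup>2)" for v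
      unfolding C by (smt (verit) divide_nonneg_nonneg zero_le_power2)
    show "\<phi> (- v) = \<phi> v" for v by (simp add: \<phi>_def)
  qed
  also have "\<phi> 0 + 2 * (\<Sum>n. \<phi> (real (Suc n))) = 1 + 2 * theta_tail a"
    by (simp add: \<phi>_def theta_tail_def mult_ac)
  also have "(\<lambda>K. \<integral>v. \<phi> v * dirichlet_kernel K v \<partial>lborel) =
      (\<lambda>K. (1 + 2 * (\<Sum>k<K. exp (- pi * (real (Suc k))\<^sup>2 * (1 / a)))) / sqrt a)"
  proof
    fix K
    have int: "integrable lborel (\<lambda>v. \<phi> v * cos (2 * pi * k * v))" for k
      by (rule Bochner_Integration.integrable_bound[OF gaussian_integrable[OF a]])
         (auto simp: \<phi>_def abs_mult)
    have "(\<integral>v. \<phi> v * dirichlet_kernel K v \<partial>lborel) =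
       (\<integral>v. \<phi> v * cos (2 * pi * 0 * v) + 2 * (\<Sum>k=1..K. \<phi> v * cos (2 * pi * real k * v)) \<partial>lborel)"
      by (intro Bochner_Integration.integral_cong refl)
         (simp add: dirichlet_kernel_def sum_distrib_left algebra_simps)
    also have "\<dots> = (\<integral>v. \<phi> v * cos (2 * pi * 0 * v) \<partial>lborel) + 
        2 * (\<Sum>k=1..K. \<integral>v. \<phi> v * cos (2 * pi * real k * v) \<partial>lborel)"
      by (subst Bochner_Integration.integral_add, rule int,
          intro Bochner_Integration.integrable_mult_right Bochner_Integration.integrable_sum int,
          subst Bochner_Integration.integral_mult_right_zero, subst Bochner_Integration.integral_sum, rule int) simp
    also have "\<dots> = (1 + 2 * (\<Sum>k=1..K. exp (- pi * (real k)\<^sup>2 / a))) / sqrt a"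
      unfolding \<phi>_def gaussian_fourier_transform[OF a]
      by (simp add: add_divide_distrib sum_divide_distrib[symmetric])
    also have "(\<Sum>k=1..K. exp (- pi * (real k)\<^sup>2 / a)) = (\<Sum>k<K. exp (- pi * (real (Suc k))\<^sup>2 * (1 / a)))"
      by (rule sum.reindex_bij_witness[of _ Suc "\<lambda>k. k - 1"]) auto
    finally show "(\<integral>v. \<phi> v * dirichlet_kernel K v \<partial>lborel) =
       (1 + 2 * (\<Sum>k<K. exp (- pi * (real (Suc k))\<^sup>2 * (1 / a)))) / sqrt a" .
  qed
  finally have 1: "(\<lambda>K. (1 + 2 * (\<Sum>k<K. exp (- pi * (real (Suc k))\<^sup>2 * (1 / a)))) / sqrt a)
     \<longlonglongrightarrow> 1 + 2 * theta_tail a" .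
  have "(\<lambda>K. (1 + 2 * (\<Sum>k<K. exp (- pi * (real (Suc k))\<^sup>2 * (1 / a)))) / sqrt a)
     \<longlonglongrightarrow> (1 + 2 * theta_tail (1 / a)) / sqrt a"
    unfolding theta_tail_def using a
    by (intro tendsto_intros summable_LIMSEQ summable_theta_tail) auto
  from LIMSEQ_unique[OF 1 this] show ?thesis using a by (simp add: field_simps)
qed

section \<open>The Mellin transform of the theta function\<close>

text \<open>
Expanding the exponential and integrating term by term gives a power series that converges for
every \<open>s\<close>. The interchange is dominated by $e^{|s||v|}|f(v)|$.
\<close>

lemma entire_exponential_integral:
  fixes f :: "real \<Rightarrow> real"
  assumes [measurable]: "f \<in> borel_measurable borel"
    and int: "\<And>r. integrable lborel (\<lambda>v. exp (r * \<bar>v\<bar>) * \<bar>f v\<bar>)"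
  shows "(\<lambda>s. \<integral>v. exp (of_real v * s) * complex_of_real (f v) \<partial>lborel) holomorphic_on A"
proof -
  define F where "F n s v = (of_real v * s) ^ n / fact n * complex_of_real (f v)" for n s v
  define a where "a n = (\<integral>v. F n 1 v \<partial>lborel)" for n
  have bound: "(\<Sum>n<N. norm (F n s v)) \<le> exp (norm s * \<bar>v\<bar>) * \<bar>f v\<bar>" for N s v
  proof -
    have "(\<Sum>n<N. norm (F n s v)) = (\<Sum>n<N. (norm s * \<bar>v\<bar>) ^ n /\<^sub>R fact n) * \<bar>f v\<bar>"
      by (simp add: F_def norm_mult norm_divide norm_power sum_distrib_right divide_inverse norm_inverse sum_distrib_left mult_ac)
    also have "(\<Sum>n<N. (norm s * \<bar>v\<bar>) ^ n /\<^sub>R fact n) \<le> exp (norm s * \<bar>v\<bar>)"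
    proof -
      have "(\<lambda>n. (norm s * \<bar>v\<bar>) ^ n /\<^sub>R fact n) sums exp (norm s * \<bar>v\<bar>)" by (rule exp_converges)
      from sums_summable[OF this] sums_unique[OF this] show ?thesis
        using sum_le_suminf[of "\<lambda>n. (norm s * \<bar>v\<bar>) ^ n /\<^sub>R fact n" "{..<N}"] by auto
    qed
    finally show ?thesis by (simp add: mult_right_mono)
  qed
  have bound1: "norm (F n s v) \<le> exp (norm s * \<bar>v\<bar>) * \<bar>f v\<bar>" for n s v
  proof -
    have "0 \<le> (\<Sum>k<n. norm (F k s v))" by (intro sum_nonneg) auto
    thus ?thesis using bound[where N = "Suc n" and s = s and v = v] by simp
  qed
  have [measurable]: "F n s \<in> borel_measurable borel" for n s unfolding F_def by measurable
  have intF: "integrable lborel (F n s)" for n s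
    by (rule Bochner_Integration.integrable_bound[OF int[of "norm s"]]) (auto intro: bound1)
  have "(\<lambda>n. a n * s ^ n) sums (\<integral>v. exp (of_real v * s) * complex_of_real (f v) \<partial>lborel)" for s
  proof -
    have "(\<lambda>n. \<integral>v. F n s v \<partial>lborel) sums (\<integral>v. (\<Sum>n. F n s v) \<partial>lborel)"
    proof (rule sums_integral[OF intF])
      show "AE v in lborel. summable (\<lambda>n. norm (F n s v))"
        by (intro AE_I2 summableI_nonneg_bounded) (rule norm_ge_zero, rule bound)
      show "summable (\<lambda>n. \<integral>v. norm (F n s v) \<partial>lborel)"
      proof (rule summableI_nonneg_bounded)
        fix N
        have "(\<Sum>n<N. \<integral>v. norm (F n s v) \<partial>lborel) = (\<integral>v. (\<Sum>n<N. norm (F n s v)) \<partial>lborel)"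
          by (subst Bochner_Integration.integral_sum) (auto intro: intF)
        also have "\<dots> \<le> (\<integral>v. exp (norm s * \<bar>v\<bar>) * \<bar>f v\<bar> \<partial>lborel)"
          by (intro integral_mono Bochner_Integration.integrable_sum integrable_norm intF int bound)
        finally show "(\<Sum>n<N. \<integral>v. norm (F n s v) \<partial>lborel) \<le> (\<integral>v. exp (norm s * \<bar>v\<bar>) * \<bar>f v\<bar> \<partial>lborel)" .
      qed auto
    qed
    also have "(\<integral>v. (\<Sum>n. F n s v) \<partial>lborel) = (\<integral>v. exp (of_real v * s) * complex_of_real (f v) \<partial>lborel)"
    proof (intro Bochner_Integration.integral_cong refl)
      fix v :: real
      have "(\<lambda>n. F n s v) sums (exp (of_real v * s) * complex_of_real (f v))"
        unfolding F_def using exp_converges[of "complex_of_real v * s"]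
        by (intro sums_mult2) (simp add: scaleR_conv_of_real field_simps)
      thus "(\<Sum>n. F n s v) = exp (of_real v * s) * complex_of_real (f v)" by (simp add: sums_iff)
    qed
    also have "(\<lambda>n. \<integral>v. F n s v \<partial>lborel) = (\<lambda>n. a n * s ^ n)"
    proof
      fix n
      have "(\<integral>v. F n s v \<partial>lborel) = (\<integral>v. F n 1 v * s ^ n \<partial>lborel)"
        by (intro Bochner_Integration.integral_cong) (auto simp: F_def power_mult_distrib)
      thus "(\<integral>v. F n s v \<partial>lborel) = a n * s ^ n" by (simp add: a_def)
    qed
    finally show ?thesis .
  qed
  hence *: "(\<lambda>s. \<integral>v. exp (of_real v * s) * complex_of_real (f v) \<partial>lborel) holomorphic_on ball 0 r" for r
    by (intro power_series_holomorphic[where a = a]) auto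
  show ?thesis
  proof (rule holomorphic_on_subset[OF _ subset_UNIV])
    show "(\<lambda>s. \<integral>v. exp (of_real v * s) * complex_of_real (f v) \<partial>lborel) holomorphic_on UNIV"
    proof (subst holomorphic_on_open, safe)
      fix s :: complex
      have "s \<in> ball 0 (norm s + 1)" by simp
      with *[of "norm s + 1"] show "\<exists>f'. ((\<lambda>s. \<integral>v. exp (of_real v * s) * complex_of_real (f v) \<partial>lborel) has_field_derivative f') (at s)"
        by (subst (asm) holomorphic_on_open) auto
    qed auto
  qed
qed

text \<open>
The factor that completes $\zeta$ to a function symmetric under $s \mapsto 1 - s$, up to poles.
\<close>

definition completed_factor :: "complex \<Rightarrow> complex" where
  "completed_factor s = of_real pi powr (- s / 2) * Gamma (s / 2)"

text \<open>
Euler's integral for $\Gamma(s/2)$ under the substitution $t = \pi n^2 e^{2v}$. In the logarithmic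
variable \<open>v\<close> the inversion $x \mapsto 1/x$ of the theta function becomes the reflection $v \mapsto -v$.
\<close>

lemma gaussian_exponential_integral:
  fixes n :: nat
  assumes s: "Re s > 0" and n: "n > 0"
  defines "F \<equiv> (\<lambda>v. exp (of_real v * s) * complex_of_real (2 * exp (- pi * (real n)\<^sup>2 * exp (2 * v))))"
  shows "integrable lborel F" and "(\<integral>v. F v \<partial>lborel) = completed_factor s * (1 / of_nat n powr s)"
proof -
  define c where "c = pi * (real n)\<^sup>2"
  define C where "C = of_real pi powr (s / 2) * of_nat n powr s"
  have c: "c > 0" using n by (simp add: c_def)
  define g where "g v = c * exp (2 * v)" for v
  define f where "f t = complex_of_real t powr (s / 2 - 1) / of_real (exp t)" for t :: real
  have g_deriv: "(g has_real_derivative 2 * (c * exp (2 * v))) (at v)" for v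
    unfolding g_def by (auto intro!: derivative_eq_intros)
  have img: "g ` UNIV = {0<..}"
  proof safe
    fix t :: real assume "t > 0"
    hence "t = g (ln (t / c) / 2)" using c by (simp add: g_def)
    thus "t \<in> range g" by blast
  qed (use c in \<open>auto simp: g_def\<close>)
  have cpow: "complex_of_real c powr (s / 2) = C"
  proof -
    have "ln c = ln pi + 2 * ln (real n)"
      using n by (simp add: c_def ln_mult ln_realpow)
    hence "complex_of_real c powr (s / 2) = exp (s / 2 * of_real (ln pi) + s * of_real (ln (real n)))"
      using c by (simp add: powr_def Ln_of_real algebra_simps)
    also have "\<dots> = C"
    proof -
      have "Ln (complex_of_real pi) = of_real (ln pi)" "Ln (of_nat n) = complex_of_real (ln (real n))"
        using n Ln_of_real[of pi] Ln_of_real[of "real n"] by auto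
      thus ?thesis using n unfolding C_def powr_def by (simp add: exp_add)
    qed
    finally show ?thesis .
  qed
  have eq: "\<bar>2 * g v\<bar> *\<^sub>R f (g v) = C * F v" for v
  proof -
    have g: "g v > 0" using c by (simp add: g_def)
    have "complex_of_real (g v) powr (s / 2) = C * exp (of_real v * s)"
    proof -
      have "complex_of_real (g v) powr (s / 2) = complex_of_real c powr (s / 2) * of_real (exp (2 * v)) powr (s / 2)"
        using c by (simp add: g_def powr_times_real)
      also have "complex_of_real (exp (2 * v)) powr (s / 2) = exp (of_real v * s)"
      proof -
        have "Ln (complex_of_real (exp (2 * v))) = of_real (2 * v)"
          by (subst Ln_of_real) auto
        thus ?thesis unfolding powr_def by (simp add: mult_ac)
      qed
      finally show ?thesis by (simp add: cpow)
    qed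
    moreover have "complex_of_real (g v) powr (s / 2) = complex_of_real (g v) * complex_of_real (g v) powr (s / 2 - 1)"
      using g by (simp add: powr_diff)
    moreover have "complex_of_real (exp (- pi * (real n)\<^sup>2 * exp (2 * v))) = 1 / of_real (exp (g v))"
    proof -
      have "exp (- pi * (real n)\<^sup>2 * exp (2 * v)) = 1 / exp (g v)"
        by (simp add: g_def c_def exp_minus field_simps)
      thus ?thesis by (simp only: of_real_divide of_real_1)
    qed
    ultimately show ?thesis
      using g by (simp add: f_def F_def scaleR_conv_of_real field_simps)
  qed
  have "f absolutely_integrable_on {0<..} \<and> integral {0<..} f = Gamma (s / 2)"
    unfolding f_def using s
    by (intro conjI absolutely_integrable_Gamma_integral' integral_unique Gamma_integral_complex') auto
  hence "(\<lambda>v. \<bar>2 * g v\<bar> *\<^sub>R f (g v)) absolutely_integrable_on UNIV \<and> 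
      integral UNIV (\<lambda>v. \<bar>2 * g v\<bar> *\<^sub>R f (g v)) = Gamma (s / 2)"
    unfolding img[symmetric]
    by (subst has_absolute_integral_change_of_variables_real)
       (use c in \<open>auto simp: inj_on_def g_def intro: g_deriv\<close>)
  hence 1: "(\<lambda>v. C * F v) absolutely_integrable_on UNIV" "integral UNIV (\<lambda>v. C * F v) = Gamma (s / 2)"
    by (simp_all only: eq)
  have C: "C \<noteq> 0" using n by (simp add: C_def)
  have [measurable]: "F \<in> borel_measurable borel" unfolding F_def by measurable
  have 2: "integrable lborel (\<lambda>v. C * F v)"
    using 1(1) unfolding set_integrable_def by (simp add: integrable_completion)
  thus int: "integrable lborel F"
    using C integrable_mult_right[of "1 / C" lborel "\<lambda>v. C * F v"] by simp
  have "Gamma (s / 2) = (\<integral>v. C * F v \<partial>lborel)"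
    using integral_lborel[OF 2] 1(2) by (simp only:)
  hence "(\<integral>v. F v \<partial>lborel) = Gamma (s / 2) / C" using C by simp
  thus "(\<integral>v. F v \<partial>lborel) = completed_factor s * (1 / of_nat n powr s)"
    by (simp add: C_def completed_factor_def powr_minus field_simps)
qed

text \<open>
The function $2\omega$ in the variable $v$ with $x = e^{2v}$; the factor $2$ comes from $dx = 2 e^{2v}\,dv$.
\<close>

definition theta_weight :: "real \<Rightarrow> real" where
  "theta_weight v = 2 * theta_tail (exp (2 * v))"

lemma theta_weight_measurable [measurable]: "theta_weight \<in> borel_measurable borel"
  unfolding theta_weight_def theta_tail_def by measurable

lemma theta_tail_nonneg: "x > 0 \<Longrightarrow> theta_tail x \<ge> 0"
  unfolding theta_tail_def by (intro suminf_nonneg summable_theta_tail) auto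

lemma theta_weight_nonneg: "theta_weight v \<ge> 0"
  by (simp add: theta_weight_def theta_tail_nonneg)

lemma theta_weight_reflect:
  "theta_weight (- v) = exp v * theta_weight v + (exp v - 1)"
proof -
  have "1 + 2 * theta_tail (1 / exp (2 * v)) = sqrt (exp (2 * v)) * (1 + 2 * theta_tail (exp (2 * v)))"
    by (rule theta_tail_inversion) simp
  also have "sqrt (exp (2 * v)) = exp v"
    by (simp add: exp_double)
  finally show ?thesis by (simp add: theta_weight_def exp_minus field_simps)
qed

text \<open>
Summation of \<open>gaussian_exponential_integral\<close> over \<open>n\<close>. Replacing \<open>s\<close> by its real part turns each
integrand into its absolute value, so absolute convergence of the interchange is the convergence of
$\sum n^{-\sigma}$ for $\sigma > 1$.
\<close>

lemma
  assumes s: "Re s > 1"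
  shows theta_weight_mellin_integrable:
      "integrable lborel (\<lambda>v. exp (of_real v * s) * complex_of_real (theta_weight v))" (is ?I)
    and theta_weight_mellin_sums: "(\<lambda>n. completed_factor s * (1 / of_nat (Suc n) powr s)) sums
           (\<integral>v. exp (of_real v * s) * complex_of_real (theta_weight v) \<partial>lborel)" (is ?S)
proof -
  define F where "F n s v = exp (of_real v * s) * complex_of_real (2 * exp (- pi * (real (Suc n))\<^sup>2 * exp (2 * v)))" for n s v
  have int: "integrable lborel (F n s)" and I: "(\<integral>v. F n s v \<partial>lborel) = completed_factor s * (1 / of_nat (Suc n) powr s)"
    if "Re s > 0" for n s
    using gaussian_exponential_integral[OF that, of "Suc n"] unfolding F_def by auto
  have norm_F: "complex_of_real (norm (F n s v)) = F n (of_real (Re s)) v" for n v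
  proof -
    have "exp (of_real v * of_real (Re s)) = complex_of_real (exp (v * Re s))"
      by (metis exp_of_real of_real_mult)
    thus ?thesis by (simp add: F_def norm_mult)
  qed
  have F_sums: "(\<lambda>n. F n s v) sums (exp (of_real v * s) * complex_of_real (theta_weight v))" for s v
  proof -
    have "(\<lambda>n. 2 * exp (- pi * (real (Suc n))\<^sup>2 * exp (2 * v))) sums theta_weight v"
      unfolding theta_weight_def theta_tail_def
      by (intro sums_mult summable_sums summable_theta_tail) auto
    thus ?thesis unfolding F_def by (intro sums_mult) (simp only: sums_of_real_iff)
  qed
  have 1: "AE v in lborel. summable (\<lambda>n. norm (F n s v))"
  proof (intro AE_I2)
    fix v
    have "summable (\<lambda>n. complex_of_real (norm (F n s v)))"
      unfolding norm_F by (rule sums_summable[OF F_sums])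
    thus "summable (\<lambda>n. norm (F n s v))" by (simp only: summable_of_real_iff)
  qed
  have 2: "summable (\<lambda>n. \<integral>v. norm (F n s v) \<partial>lborel)"
  proof -
    have "complex_of_real (\<integral>v. norm (F n s v) \<partial>lborel) =
        completed_factor (of_real (Re s)) * of_real (real (Suc n) powr (- Re s))" for n
    proof -
      have "complex_of_real (\<integral>v. norm (F n s v) \<partial>lborel) = (\<integral>v. F n (of_real (Re s)) v \<partial>lborel)"
        by (simp only: integral_complex_of_real[symmetric] norm_F)
      also have "\<dots> = completed_factor (of_real (Re s)) * (1 / of_real (real (Suc n)) powr of_real (Re s))"
        using s by (subst I) auto
      also have "1 / of_real (real (Suc n)) powr of_real (Re s) = complex_of_real (real (Suc n) powr (- Re s))"
        by (subst powr_of_real) (auto simp: powr_minus divide_inverse)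
      finally show ?thesis .
    qed
    moreover have "summable (\<lambda>n. real (Suc n) powr (- Re s))"
      using s summable_real_powr_iff[of "- Re s"] summable_Suc_iff[of "\<lambda>n. real n powr (- Re s)"] by simp
    hence "summable (\<lambda>n. completed_factor (of_real (Re s)) * of_real (real (Suc n) powr (- Re s)))"
      by (intro summable_mult) (simp only: summable_of_real_iff)
    ultimately have "summable (\<lambda>n. complex_of_real (\<integral>v. norm (F n s v) \<partial>lborel))" by simp
    thus ?thesis by (simp only: summable_of_real_iff)
  qed
  have eq: "(\<lambda>v. \<Sum>n. F n s v) = (\<lambda>v. exp (of_real v * s) * complex_of_real (theta_weight v))"
    using F_sums by (auto simp: sums_iff)
  have s0: "Re s > 0" using s by simp
  show ?I using integrable_suminf[OF int[OF s0] 1 2] unfolding eq .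
  show ?S using sums_integral[OF int[OF s0] 1 2] unfolding eq I[OF s0] .
qed

text \<open>
The restriction to $v > 0$, that is, to the range $x > 1$ where $\omega$ decays rapidly. Its
exponential integral \<open>half_mellin\<close> is the function $G$ of the introduction.
\<close>

definition half_weight :: "real \<Rightarrow> real" where
  "half_weight v = indicator {0<..} v * theta_weight v"

definition half_mellin :: "complex \<Rightarrow> complex" where
  "half_mellin s = (\<integral>v. exp (of_real v * s) * complex_of_real (half_weight v) \<partial>lborel)"

lemma half_weight_measurable [measurable]: "half_weight \<in> borel_measurable borel"
  unfolding half_weight_def by measurable

lemma half_weight_nonneg: "half_weight v \<ge> 0"
  by (simp add: half_weight_def theta_weight_nonneg)

text \<open>
For positive \<open>v\<close> the exponential grows with its exponent, so integrability for one large exponent,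
known from the Mellin transform, implies it for all.
\<close>

lemma half_weight_integrable: "integrable lborel (\<lambda>v. exp (r * \<bar>v\<bar>) * \<bar>half_weight v\<bar>)"
proof (rule Bochner_Integration.integrable_bound)
  define R where "R = max r 2"
  show "integrable lborel (\<lambda>v. exp (of_real v * of_real R) * complex_of_real (theta_weight v))"
    by (rule theta_weight_mellin_integrable) (simp add: R_def)
  have "exp (r * v) \<le> exp (R * v)" if "v > 0" for v
    using that by (simp add: R_def)
  thus "AE v in lborel. norm (exp (r * \<bar>v\<bar>) * \<bar>half_weight v\<bar>) \<le> norm (exp (of_real v * of_real R) * complex_of_real (theta_weight v))"
    by (auto simp: half_weight_def norm_mult mult.commute[of R] mult.commute[of r] intro!: mult_right_mono split: split_indicator)
qed measurable

lemma half_mellin_integrable: "integrable lborel (\<lambda>v. exp (of_real v * s) * complex_of_real (half_weight v))"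
proof (rule Bochner_Integration.integrable_bound[OF half_weight_integrable[of "norm s"]])
  have "v * Re s \<le> norm s * \<bar>v\<bar>" for v
    using abs_Re_le_cmod[of s] mult_left_mono[of "\<bar>Re s\<bar>" "norm s" "\<bar>v\<bar>"] 
    by (metis abs_ge_self abs_ge_zero abs_mult mult.commute order_trans)
  thus "AE v in lborel. norm (exp (of_real v * s) * complex_of_real (half_weight v)) \<le> norm (exp (norm s * \<bar>v\<bar>) * \<bar>half_weight v\<bar>)"
    by (auto simp: norm_mult intro!: mult_right_mono)
qed measurable

lemma half_mellin_holomorphic: "half_mellin holomorphic_on A"
  unfolding half_mellin_def[abs_def]
  by (rule entire_exponential_integral[OF half_weight_measurable half_weight_integrable])

lemma half_mellin_cnj: "half_mellin (cnj s) = cnj (half_mellin s)"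
proof -
  have "half_mellin (cnj s) = (\<integral>v. cnj (exp (of_real v * s) * complex_of_real (half_weight v)) \<partial>lborel)"
    unfolding half_mellin_def by (intro Bochner_Integration.integral_cong) (auto simp: exp_cnj)
  thus ?thesis by (simp only: Bochner_Integration.integral_cnj half_mellin_def)
qed

lemma exponential_integral_halfline:
  assumes "Re c > 0"
  shows "integrable lborel (\<lambda>v. indicator {0<..} v *\<^sub>R exp (- (c * of_real v)))"
    and "(\<integral>v. indicator {0<..} v *\<^sub>R exp (- (c * of_real v)) \<partial>lborel) = 1 / c"
proof -
  have int: "set_integrable lborel {0<..} (\<lambda>v. exp (- (c * of_real v)))"
    unfolding set_integrable_def
  proof (rule Bochner_Integration.integrable_bound)
    show "integrable lborel (\<lambda>v. indicator {0<..} v *\<^sub>R exp (- (v * Re c)))"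
      using integrable_I0i_exp_mscale[OF assms] by (simp add: set_integrable_def)
  qed (auto split: split_indicator)
  thus "integrable lborel (\<lambda>v. indicator {0<..} v *\<^sub>R exp (- (c * of_real v)))"
    by (simp add: set_integrable_def)
  have c: "c \<noteq> 0" using assms by auto
  have "(LBINT v=0..\<infinity>. exp (- (c * of_real v))) = 0 - (- (1 / c))"
  proof (rule interval_integral_FTC_integrable)
    show "((\<lambda>v. - exp (- (c * of_real v)) / c) has_vector_derivative exp (- (c * of_real x))) (at x)" for x
      using c by (auto intro!: derivative_eq_intros has_vector_derivative_real_field)
    show "set_integrable lborel (einterval 0 \<infinity>) (\<lambda>v. exp (- (c * of_real v)))"
      using int by (simp add: zero_ereal_def)
    have "((\<lambda>v. - exp (- (c * of_real v)) / c) \<longlongrightarrow> - exp (- (c * of_real 0)) / c) (at_right 0)"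
      using c by (intro tendsto_intros) auto
    thus "(((\<lambda>v. - exp (- (c * of_real v)) / c) \<circ> real_of_ereal) \<longlongrightarrow> - (1 / c)) (at_right 0)"
      unfolding zero_ereal_def by (simp add: ereal_tendsto_simps)
    have "((\<lambda>v. exp (- (v * Re c))) \<longlongrightarrow> 0) at_top"
    proof -
      have "filterlim (\<lambda>v. Re c * v) at_top at_top"
        by (rule filterlim_tendsto_pos_mult_at_top[OF tendsto_const assms filterlim_ident])
      hence "filterlim (\<lambda>v. - (Re c * v)) at_bot at_top" by (simp add: filterlim_uminus_at_bot)
      from filterlim_compose[OF exp_at_bot this] show ?thesis by (simp add: mult.commute)
    qed
    hence "((\<lambda>v. norm (exp (- (c * of_real v)))) \<longlongrightarrow> 0) at_top" by (simp add: mult.commute)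
    hence "((\<lambda>v. exp (- (c * of_real v))) \<longlongrightarrow> 0) at_top" by (rule tendsto_norm_zero_cancel)
    hence "((\<lambda>v. - exp (- (c * of_real v)) / c) \<longlongrightarrow> - 0 / c) at_top" using c by (intro tendsto_intros)
    thus "(((\<lambda>v. - exp (- (c * of_real v)) / c) \<circ> real_of_ereal) \<longlongrightarrow> 0) (at_left \<infinity>)"
      by (simp add: ereal_tendsto_simps)
  qed auto
  thus "(\<integral>v. indicator {0<..} v *\<^sub>R exp (- (c * of_real v)) \<partial>lborel) = 1 / c"
    by (simp add: interval_lebesgue_integral_0_infty set_lebesgue_integral_def)
qed

text \<open>
The part of the integral over $v < 0$ is reflected to $v > 0$, where the inversion formula for the
theta function replaces the weight at $-v$ by $e^v$ times the weight at $v$ plus $e^v - 1$. The first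
summand exchanges $s$ and $1 - s$; the second integrates to elementary terms.
\<close>

lemma theta_weight_mellin_split:
  assumes s: "Re s > 1"
  shows "(\<integral>v. exp (of_real v * s) * complex_of_real (theta_weight v) \<partial>lborel) =
     half_mellin s + half_mellin (1 - s) + (1 / (s - 1) - 1 / s)"
proof -
  define F where "F v = exp (of_real v * s) * complex_of_real (theta_weight v)" for v
  have [measurable]: "F \<in> borel_measurable borel" unfolding F_def by measurable
  have int: "integrable lborel F" unfolding F_def by (rule theta_weight_mellin_integrable[OF s])
  have "(\<integral>v. F v \<partial>lborel) = (\<integral>v. indicator {0<..} v *\<^sub>R F v + indicator {..<0} v *\<^sub>R F v \<partial>lborel)"
  proof (rule integral_cong_AE)
    show "AE v in lborel. F v = indicator {0<..} v *\<^sub>R F v + indicator {..<0} v *\<^sub>R F v"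
      using AE_lborel_singleton[of "0 :: real"]
      by eventually_elim (auto split: split_indicator)
  qed measurable
  also have "\<dots> = (\<integral>v. indicator {0<..} v *\<^sub>R F v \<partial>lborel) + (\<integral>v. indicator {..<0} v *\<^sub>R F v \<partial>lborel)"
    by (intro Bochner_Integration.integral_add integrable_mult_indicator int) auto
  also have "(\<integral>v. indicator {0<..} v *\<^sub>R F v \<partial>lborel) = half_mellin s"
    unfolding half_mellin_def
    by (intro Bochner_Integration.integral_cong) (auto simp: F_def half_weight_def split: split_indicator)
  also have "(\<integral>v. indicator {..<0} v *\<^sub>R F v \<partial>lborel) = (\<integral>v. indicator {..<0} (- v) *\<^sub>R F (- v) \<partial>lborel)"
    by (subst lborel_integral_real_affine[where c = "-1" and t = 0]) auto
  also have "\<dots> = (\<integral>v. exp (of_real v * (1 - s)) * complex_of_real (half_weight v) + 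
      (indicator {0<..} v *\<^sub>R exp (- ((s - 1) * of_real v)) - indicator {0<..} v *\<^sub>R exp (- (s * of_real v))) \<partial>lborel)"
  proof (intro Bochner_Integration.integral_cong refl)
    fix v :: real
    have "exp (of_real v * (1 - s)) = exp (of_real v) * exp (- (s * of_real v))"
      "exp (- ((s - 1) * of_real v)) = exp (of_real v) * exp (- (s * of_real v))"
      by (simp_all add: algebra_simps flip: exp_add)
    thus "indicator {..<0} (- v) *\<^sub>R F (- v) = exp (of_real v * (1 - s)) * complex_of_real (half_weight v) + 
      (indicator {0<..} v *\<^sub>R exp (- ((s - 1) * of_real v)) - indicator {0<..} v *\<^sub>R exp (- (s * of_real v)))"
      by (auto simp: F_def half_weight_def theta_weight_reflect algebra_simps exp_of_real split: split_indicator)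
  qed
  also have "\<dots> = half_mellin (1 - s) + (1 / (s - 1) - 1 / s)"
    using s half_mellin_integrable[of "1 - s"] exponential_integral_halfline[of s] exponential_integral_halfline[of "s - 1"]
    by (simp add: half_mellin_def)
  finally show ?thesis by (simp add: F_def)
qed

section \<open>The continuation of zeta and the entire function xi\<close>

text \<open>
The right-hand side of \<open>theta_weight_mellin_split\<close> multiplied by $s(s-1)/2$, which makes sense
for all \<open>s\<close>.
\<close>

definition xi_entire :: "complex \<Rightarrow> complex" where
  "xi_entire s = s * (s - 1) / 2 * (half_mellin s + half_mellin (1 - s)) + 1 / 2"

text \<open>
Solving the definition of $\xi$ for $\zeta$. The reciprocal Gamma function is entire, and
$\frac{1}{s\,\Gamma(s/2)} = \frac{1}{2\,\Gamma(s/2 + 1)}$ absorbs the factor $s$, so that only the pole at $1$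
remains; there the quotient has the value $0$.
\<close>

definition zeta_continued :: "complex \<Rightarrow> complex" where
  "zeta_continued s = xi_entire s * of_real pi powr (s / 2) * rGamma (s / 2 + 1) / (s - 1)"

lemma xi_entire_holomorphic: "xi_entire holomorphic_on A"
proof -
  have "(half_mellin \<circ> (\<lambda>s. 1 - s)) holomorphic_on A"
    by (rule holomorphic_on_compose) (auto intro!: holomorphic_intros half_mellin_holomorphic)
  thus ?thesis unfolding xi_entire_def[abs_def] o_def
    by (intro holomorphic_intros half_mellin_holomorphic) auto
qed

lemma xi_entire_reflect: "xi_entire (1 - s) = xi_entire s"
  by (simp add: xi_entire_def algebra_simps)

lemma xi_entire_cnj: "xi_entire (cnj s) = cnj (xi_entire s)"
  using half_mellin_cnj[of "1 - s"] by (simp add: xi_entire_def half_mellin_cnj)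

lemma completed_factor_nonzero: "s / 2 \<notin> \<int>\<^sub>\<le>\<^sub>0 \<Longrightarrow> completed_factor s \<noteq> 0"
  by (simp add: completed_factor_def Gamma_eq_zero_iff)

lemma half_notin_nonpos_Ints: "Re s > 0 \<Longrightarrow> s / 2 \<notin> \<int>\<^sub>\<le>\<^sub>0"
  by (auto elim!: nonpos_Ints_cases simp: complex_eq_iff)

lemma completed_factor_times_zeta_continued:
  assumes "s / 2 \<notin> \<int>\<^sub>\<le>\<^sub>0"
  shows "completed_factor s * zeta_continued s = 2 * xi_entire s / (s * (s - 1))"
proof -
  have s: "s \<noteq> 0" using assms by auto
  have "rGamma (s / 2) \<noteq> 0" using assms by (simp add: rGamma_eq_zero_iff)
  hence "Gamma (s / 2) * rGamma (s / 2) = 1" by (simp add: Gamma_def)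
  hence "Gamma (s / 2) * (s / 2 * rGamma (s / 2 + 1)) = 1" by (simp only: rGamma_plus1)
  hence 1: "Gamma (s / 2) * rGamma (s / 2 + 1) = 2 / s" using s by (simp add: field_simps)
  have 2: "complex_of_real pi powr (- s / 2) * of_real pi powr (s / 2) = 1"
    by (simp add: powr_minus)
  have "completed_factor s * zeta_continued s = (complex_of_real pi powr (- s / 2) * of_real pi powr (s / 2)) *
      (Gamma (s / 2) * rGamma (s / 2 + 1)) * xi_entire s / (s - 1)"
    unfolding completed_factor_def zeta_continued_def by simp
  also have "\<dots> = 2 * xi_entire s / (s * (s - 1))" unfolding 1 2 by simp
  finally show ?thesis .
qed

lemma zeta_continued_sums:
  assumes "Re s > 1"
  shows "(\<lambda>n. 1 / of_nat (Suc n) powr s) sums zeta_continued s"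
proof -
  have s: "s \<noteq> 0" "s \<noteq> 1" using assms by auto
  have nz: "completed_factor s \<noteq> 0" "s / 2 \<notin> \<int>\<^sub>\<le>\<^sub>0"
    using assms half_notin_nonpos_Ints[of s] completed_factor_nonzero by auto
  have "half_mellin s + half_mellin (1 - s) + (1 / (s - 1) - 1 / s) = 2 * xi_entire s / (s * (s - 1))"
    using s by (simp add: xi_entire_def divide_simps) (simp add: algebra_simps)
  also have "\<dots> = completed_factor s * zeta_continued s"
    using completed_factor_times_zeta_continued[OF nz(2)] by simp
  finally have "(\<lambda>n. completed_factor s * (1 / of_nat (Suc n) powr s)) sums (completed_factor s * zeta_continued s)"
    using theta_weight_mellin_sums[OF assms] theta_weight_mellin_split[OF assms] by simp
  from sums_divide[OF this, of "completed_factor s"] nz(1) show ?thesis by simp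
qed

lemma zeta_continued_holomorphic: "zeta_continued holomorphic_on - {1}"
  unfolding zeta_continued_def[abs_def]
  by (intro holomorphic_intros xi_entire_holomorphic) auto

text \<open>
Two continuations agree on the half plane of convergence, hence on the connected set $- \{1\}$, and
both take the value $0$ at $1$.
\<close>

lemma zeta_eq: "zeta = zeta_continued"
  unfolding zeta_def
proof (rule the_equality, intro conjI allI impI)
  show "zeta_continued holomorphic_on - {1}" by (rule zeta_continued_holomorphic)
  show "(\<lambda>n. 1 / of_nat (Suc n) powr s) sums zeta_continued s" if "Re s > 1" for s
    by (rule zeta_continued_sums[OF that])
  show "zeta_continued 1 = 0" by (simp add: zeta_continued_def)
next
  fix f :: "complex \<Rightarrow> complex"
  assume f: "f holomorphic_on - {1} \<and> (\<forall>s. Re s > 1 \<longrightarrow> (\<lambda>n. 1 / of_nat (Suc n) powr s) sums f s) \<and> f 1 = 0"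
  show "f = zeta_continued"
  proof
    fix s
    show "f s = zeta_continued s"
    proof (cases "s = 1")
      case False
      show ?thesis
      proof (rule analytic_continuation_open[of "{s. Re s > 1}" "- {1}" f zeta_continued])
        have "(2 :: complex) \<in> {s. Re s > 1}" by simp
        thus "{s. Re s > 1} \<noteq> {}" by blast
        show "f s = zeta_continued s" if "s \<in> {s. Re s > 1}" for s
          using that f zeta_continued_sums[of s] sums_unique2 by blast
      qed (use f zeta_continued_holomorphic False in \<open>auto simp: open_halfspace_Re_gt connected_punctured_universe\<close>)
    qed (use f in \<open>simp add: zeta_continued_def\<close>)
  qed
qed

lemma xi_formula:
  assumes "s / 2 \<notin> \<int>\<^sub>\<le>\<^sub>0" "s \<noteq> 1"
  shows "xi_entire s = s / 2 * (s - 1) * completed_factor s * zeta s"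
proof -
  have "s \<noteq> 0" using assms by auto
  have "s / 2 * (s - 1) * completed_factor s * zeta s = s / 2 * (s - 1) * (2 * xi_entire s / (s * (s - 1)))"
    unfolding zeta_eq completed_factor_times_zeta_continued[OF assms(1), symmetric] by simp
  also have "\<dots> = xi_entire s" using assms \<open>s \<noteq> 0\<close> by simp
  finally show ?thesis ..
qed

text \<open>
The defining formula agrees with the entire function except at $1$ and at the poles of $\Gamma(s/2)$,
which form a discrete set. So the limits that remove the singularities are the values of the entire
function.
\<close>

lemma xi_eq: "xi = xi_entire"
proof
  fix s
  \<comment> \<open>Sets of integers are closed, so after removing \<open>s / 2\<close> from the poles of Gamma a neighbourhood of \<open>s / 2\<close> is free of them.\<close>
  define A :: "complex set" where "A = \<int>\<^sub>\<le>\<^sub>0 - {s / 2}"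
  have "closed A" unfolding A_def by (rule closed_subset_Ints) (auto elim!: nonpos_Ints_cases)
  have "((\<lambda>w. w / 2) \<longlongrightarrow> s / 2) (at s)" by (intro tendsto_intros) auto
  hence "eventually (\<lambda>w. w / 2 \<in> - A) (at s)"
    by (rule topological_tendstoD[OF _ open_Compl[OF \<open>closed A\<close>]]) (auto simp: A_def)
  hence ev: "eventually (\<lambda>w. xi_entire w = w / 2 * (w - 1) * of_real pi powr (- w / 2) * Gamma (w / 2) * zeta w) (at s)"
    using eventually_neq_at_within[of 1 s] eventually_neq_at_within[of s s]
  proof eventually_elim
    case (elim w)
    hence "w / 2 \<notin> \<int>\<^sub>\<le>\<^sub>0" by (auto simp: A_def)
    from xi_formula[OF this elim(2)] show ?case by (simp add: completed_factor_def)
  qed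
  have "xi_entire \<midarrow>s\<rightarrow> xi_entire s"
    using holomorphic_on_imp_continuous_on[OF xi_entire_holomorphic[of UNIV]]
    by (simp add: continuous_on_eq_continuous_at isCont_def)
  hence "(\<lambda>w. w / 2 * (w - 1) * of_real pi powr (- w / 2) * Gamma (w / 2) * zeta w) \<midarrow>s\<rightarrow> xi_entire s"
    by (rule tendsto_cong[OF ev, THEN iffD1])
  thus "xi s = xi_entire s" unfolding xi_def by (rule remove_sings_eqI)
qed

lemma zeta_sums: "Re s > 1 \<Longrightarrow> (\<lambda>n. 1 / of_nat (Suc n) powr s) sums zeta s"
  unfolding zeta_eq by (rule zeta_continued_sums)

lemma sums_inverse_squares: "(\<lambda>n. 1 / (real n + 1)\<^sup>2) sums (pi\<^sup>2 / 6)"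
proof -
  have "(\<lambda>n. 1 / real ((n + 1)\<^sup>2)) = (\<lambda>n. 1 / (real n + 1)\<^sup>2)" by auto
  thus ?thesis using inverse_squares_sums by metis
qed

lemma zeta_2: "zeta 2 = of_real (pi\<^sup>2 / 6)"
proof -
  have "(\<lambda>n. complex_of_real (1 / (real n + 1)\<^sup>2)) sums of_real (pi\<^sup>2 / 6)"
    using sums_inverse_squares by (simp only: sums_of_real_iff)
  also have "(\<lambda>n. complex_of_real (1 / (real n + 1)\<^sup>2)) = (\<lambda>n. 1 / of_nat (Suc n) powr 2)"
  proof
    fix n
    have "of_nat (Suc n) powr (2 :: complex) = of_nat (Suc n) ^ 2"
      using powr_nat[of "of_nat (Suc n)" 2] by (simp del: of_nat_Suc)
    thus "complex_of_real (1 / (real n + 1)\<^sup>2) = 1 / of_nat (Suc n) powr 2"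
      by (simp add: add.commute)
  qed
  finally have 1: "(\<lambda>n. 1 / of_nat (Suc n) powr 2) sums complex_of_real (pi\<^sup>2 / 6)" .
  have "Re 2 > 1" by simp
  from sums_unique2[OF zeta_sums[OF this] 1] show ?thesis .
qed

text \<open>
Here $|\zeta(s) - 1| \le \sum_{n \ge 2} n^{-2} = \pi^2/6 - 1 < 1$.
\<close>

lemma zeta_nonzero_on_line_2:
  assumes "Re s = 2"
  shows "zeta s \<noteq> 0"
proof -
  define f where "f n = 1 / of_nat (Suc n) powr s" for n
  have f: "f sums zeta s" unfolding f_def using assms by (intro zeta_sums) auto
  have norm_f: "norm (f n) = 1 / (real n + 1)\<^sup>2" for n
  proof -
    have "norm (of_nat (Suc n) powr s) = real (Suc n) powr 2"
      using norm_powr_real_powr[of "of_nat (Suc n)" s] assms by (simp del: of_nat_Suc)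
    thus ?thesis by (simp add: f_def norm_divide add.commute)
  qed
  have sm: "summable (\<lambda>n. norm (f n))" unfolding norm_f using sums_inverse_squares by (rule sums_summable)
  have "(\<lambda>n. f (Suc n)) sums (zeta s - f 0)" using f by (subst sums_Suc_iff) simp
  moreover have "f 0 = 1" by (simp add: f_def)
  ultimately have eq: "zeta s - 1 = (\<Sum>n. f (Suc n))" by (simp only: sums_unique)
  have "norm (zeta s - 1) \<le> (\<Sum>n. norm (f (Suc n)))"
    unfolding eq by (rule summable_norm) (use sm in \<open>simp only: summable_Suc_iff[of "\<lambda>n. norm (f n)"]\<close>)
  also have "\<dots> = (\<Sum>n. norm (f n)) - norm (f 0)"
    using suminf_split_head[OF sm] by simp
  also have "\<dots> = pi\<^sup>2 / 6 - 1"
    using sums_unique[OF sums_inverse_squares] unfolding norm_f by simp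
  also have "pi\<^sup>2 \<le> 3.2\<^sup>2" using pi_approx by (intro power_mono) auto
  hence "pi\<^sup>2 / 6 - 1 < 1" by (simp add: power2_eq_square)
  finally show ?thesis by auto
qed

lemma xi_nonzero_on_line_2: "Re s = 2 \<Longrightarrow> xi_entire s \<noteq> 0"
proof -
  assume s: "Re s = 2"
  hence 1: "s / 2 \<notin> \<int>\<^sub>\<le>\<^sub>0" by (intro half_notin_nonpos_Ints) simp
  have 2: "s \<noteq> 1" "s \<noteq> 0" using s by auto
  show ?thesis unfolding xi_formula[OF 1 2(1)]
    using 2 completed_factor_nonzero[OF 1] zeta_nonzero_on_line_2[OF s] by simp
qed

lemma completed_factor_2: "completed_factor 2 = of_real (1 / pi)"
  by (simp add: completed_factor_def powr_minus inverse_eq_divide)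

lemma xi_entire_2: "xi_entire 2 = of_real (pi / 6)"
proof -
  have "(2 :: complex) / 2 \<notin> \<int>\<^sub>\<le>\<^sub>0" by (intro half_notin_nonpos_Ints) simp
  hence "xi_entire 2 = 2 / 2 * (2 - 1) * completed_factor 2 * zeta 2" by (rule xi_formula) simp
  also have "\<dots> = of_real (1 / pi) * of_real (pi\<^sup>2 / 6)" unfolding completed_factor_2 zeta_2 by simp
  also have "\<dots> = of_real (1 / pi * (pi\<^sup>2 / 6))" by (rule of_real_mult[symmetric])
  also have "1 / pi * (pi\<^sup>2 / 6) = pi / 6" by (simp add: power2_eq_square)
  finally show ?thesis .
qed

lemma xi_entire_1: "xi_entire 1 = 1 / 2"
  by (simp add: xi_entire_def)

text \<open>
On the real line $\xi(\sigma) = \frac{\sigma(\sigma - 1)}{2}(G(\sigma) + G(1 - \sigma)) + \frac12$ with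
$G \ge 0$, which is at least $\frac12$ unless $0 < \sigma < 1$. In that interval the quadratic factor is
at least $-\frac18$, and $G(\sigma) + G(1 - \sigma) \le 2 G(2)$ because $G$ increases. Finally $G(2)$ is
at most $\frac12$, since $\xi(2) = G(2) + G(-1) + \frac12$ equals $\pi/6$.
\<close>

lemma xi_entire_real_pos: "Re (xi_entire (of_real \<sigma>)) > 0"
proof -
  define g where "g r = (\<integral>v. exp (v * r) * half_weight v \<partial>lborel)" for r
  have eq: "exp (complex_of_real v * of_real r) * of_real (half_weight v) = of_real (exp (v * r) * half_weight v)" for v r
    by (metis exp_of_real of_real_mult)
  have g: "half_mellin (of_real r) = of_real (g r)" for r
    unfolding half_mellin_def g_def eq by (rule integral_complex_of_real)
  have int: "integrable lborel (\<lambda>v. exp (v * r) * half_weight v)" for r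
    using half_mellin_integrable[of "of_real r"] unfolding eq by (simp only: complex_of_real_integrable_eq)
  have g_nonneg: "g r \<ge> 0" for r
    unfolding g_def by (intro Bochner_Integration.integral_nonneg) (simp add: half_weight_nonneg)
  have g_mono: "g r \<le> g r'" if "r \<le> r'" for r r'
    unfolding g_def
  proof (intro integral_mono int)
    fix v :: real
    show "exp (v * r) * half_weight v \<le> exp (v * r') * half_weight v"
    proof (cases "v > 0")
      case True
      hence "v * r \<le> v * r'" using that by (intro mult_left_mono) auto
      thus ?thesis by (intro mult_right_mono half_weight_nonneg) auto
    qed (simp add: half_weight_def)
  qed
  have xi: "Re (xi_entire (of_real r)) = r * (r - 1) / 2 * (g r + g (1 - r)) + 1 / 2" for r
  proof -
    have "xi_entire (of_real r) = of_real (r * (r - 1) / 2 * (g r + g (1 - r)) + 1 / 2)"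
      using g[of r] g[of "1 - r"] by (simp add: xi_entire_def)
    thus ?thesis by simp
  qed
  show ?thesis
  proof (cases "0 \<le> \<sigma> \<and> \<sigma> \<le> 1")
    case True
    have "Re (xi_entire (of_real 2)) = pi / 6" by (simp add: xi_entire_2)
    hence "g 2 + g (- 1) = pi / 6 - 1 / 2" unfolding xi by simp
    hence "g 2 \<le> 1 / 2" using g_nonneg[of "- 1"] pi_approx by auto
    hence le: "g \<sigma> + g (1 - \<sigma>) \<le> 1" using g_mono[of \<sigma> 2] g_mono[of "1 - \<sigma>" 2] True by simp
    have "0 \<le> (\<sigma> - 1 / 2)\<^sup>2" by simp
    hence "\<sigma> * (1 - \<sigma>) \<le> 1 / 4" by (simp add: power2_eq_square algebra_simps)
    hence "\<sigma> * (1 - \<sigma>) * (g \<sigma> + g (1 - \<sigma>)) \<le> 1 / 4 * 1"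
      using le True g_nonneg[of \<sigma>] g_nonneg[of "1 - \<sigma>"] by (intro mult_mono) auto
    moreover have "\<sigma> * (\<sigma> - 1) / 2 * (g \<sigma> + g (1 - \<sigma>)) = - (\<sigma> * (1 - \<sigma>) * (g \<sigma> + g (1 - \<sigma>))) / 2"
      by (simp add: algebra_simps)
    ultimately show ?thesis unfolding xi by linarith
  next
    case False
    hence "\<sigma> * (\<sigma> - 1) \<ge> 0" by (auto simp: zero_le_mult_iff)
    hence "\<sigma> * (\<sigma> - 1) / 2 * (g \<sigma> + g (1 - \<sigma>)) \<ge> 0" using g_nonneg by (intro mult_nonneg_nonneg) auto
    thus ?thesis unfolding xi by linarith
  qed
qed

section \<open>Continuous variation of the argument\<close>

text \<open>
A continuous logarithm of $f \circ g$ exists, and its total increment is $2\pi i$ times the winding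
number, that is, the integral of $f'/f$ along \<open>g\<close>. Its imaginary part, shifted to start at
\<open>a\<close>, is an admissible choice of the argument. Any two admissible choices differ by a continuous
function with values in $2\pi\mathbb{Z}$, which is constant.
\<close>

lemma cont_arg_eq_contour_integral:
  assumes S: "open S" "f holomorphic_on S" and g: "valid_path g" "path_image g \<subseteq> S"
    and nz: "\<And>z. z \<in> path_image g \<Longrightarrow> f z \<noteq> 0" and a: "is_Arg (f (pathstart g)) a"
  shows "cont_arg f g a = a + Im (contour_integral g (\<lambda>z. deriv f z / f z))"
proof -
  define p where "p = f \<circ> g"
  have vp: "valid_path p" unfolding p_def using g S by (intro valid_path_compose_holomorphic)
  have p0: "0 \<notin> path_image p" unfolding p_def using nz by (auto simp: path_image_compose)
  obtain q where q: "path q" "pathfinish q - pathstart q = 2 * of_real pi * \<i> * winding_number p 0"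
    and pq: "\<And>t. t \<in> {0..1} \<Longrightarrow> p t = 0 + exp (q t)"
    using winding_number_as_continuous_log[OF valid_path_imp_path[OF vp] p0] by blast
  have an: "f analytic_on S" using S by (simp add: analytic_on_open)
  have wn: "2 * of_real pi * \<i> * winding_number p 0 = contour_integral g (\<lambda>z. deriv f z / f z)"
  proof -
    have "2 * of_real pi * \<i> * winding_number p 0 = contour_integral p (\<lambda>w. 1 / (w - 0))"
      by (subst winding_number_valid_path[OF vp p0]) simp
    also have "\<dots> = contour_integral g (\<lambda>w. deriv f w * (1 / (f w - 0)))"
      unfolding p_def by (rule contour_integral_comp_analyticW[OF an g])
    finally show ?thesis by simp
  qed
  define \<phi> where "\<phi> t = Im (q t) + (a - Im (q 0))" for t
  have exp_a: "exp (\<i> * of_real a) = exp (\<i> * of_real (Im (q 0)))"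
  proof -
    have *: "f (pathstart g) = exp (q 0)" using pq[of 0] by (simp add: p_def pathstart_def)
    have "exp (q 0) = of_real (norm (exp (q 0))) * exp (\<i> * of_real a)"
      using a unfolding * is_Arg_def .
    moreover have "exp (q 0) = of_real (norm (exp (q 0))) * exp (\<i> * of_real (Im (q 0)))"
      by (metis exp_eq_polar cis_conv_exp norm_exp_eq_Re)
    ultimately show ?thesis by (metis exp_not_eq_zero mult_cancel_left mult_eq_0_iff)
  qed
  have arg: "is_Arg (f (g t)) (\<phi> t)" if t: "t \<in> {0..1}" for t
  proof -
    have "exp (\<i> * of_real (\<phi> t)) = exp (\<i> * of_real (Im (q t))) * (exp (\<i> * of_real a) / exp (\<i> * of_real (Im (q 0))))"
      by (simp add: \<phi>_def algebra_simps exp_add exp_diff)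
    also have "\<dots> = exp (\<i> * of_real (Im (q t)))" by (simp add: exp_a)
    finally have "exp (\<i> * of_real (\<phi> t)) = exp (\<i> * of_real (Im (q t)))" .
    moreover have "exp (q t) = of_real (norm (exp (q t))) * exp (\<i> * of_real (Im (q t)))"
      by (metis exp_eq_polar cis_conv_exp norm_exp_eq_Re)
    ultimately show ?thesis using pq[OF t] by (simp add: is_Arg_def p_def norm_mult)
  qed
  have cont: "continuous_on {0..1} \<phi>"
    unfolding \<phi>_def using q(1) by (auto simp: path_def intro!: continuous_intros)
  have uniq: "\<psi> 1 = \<phi> 1" if \<psi>: "continuous_on {0..1} \<psi>" "\<psi> 0 = a" "\<forall>t\<in>{0..1}. is_Arg (f (g t)) (\<psi> t)"
    for \<psi> :: "real \<Rightarrow> real"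
  proof -
    define h where "h t = \<psi> t - \<phi> t" for t
    have h_int: "\<exists>n::int. h t = 2 * pi * of_int n" if t: "t \<in> {0..1}" for t
    proof -
      have "f (g t) \<noteq> 0" using nz t by (auto simp: path_image_def)
      with \<psi>(3) arg[OF t] t have "exp (\<i> * of_real (\<psi> t)) = exp (\<i> * of_real (\<phi> t))"
        unfolding is_Arg_def by (metis mult_cancel_left norm_eq_zero of_real_eq_0_iff)
      then obtain n :: int where "\<i> * of_real (\<psi> t) = \<i> * of_real (\<phi> t) + (of_int (2 * n) * pi) * \<i>"
        unfolding exp_eq by blast
      hence "Im (\<i> * of_real (\<psi> t)) = Im (\<i> * of_real (\<phi> t) + (of_int (2 * n) * pi) * \<i>)" by (rule arg_cong)
      thus ?thesis by (auto simp: h_def intro!: exI[of _ n])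
    qed
    have "h constant_on {0..1}"
    proof (rule continuous_discrete_range_constant)
      show "continuous_on {0..1} h" unfolding h_def by (intro continuous_intros \<psi> cont)
      show "\<exists>e>0. \<forall>y. y \<in> {0..1} \<and> h y \<noteq> h x \<longrightarrow> e \<le> norm (h y - h x)" if x: "x \<in> {0..1}" for x
      proof (intro exI[of _ "2 * pi"] conjI allI impI)
        fix y assume y: "y \<in> {0..1} \<and> h y \<noteq> h x"
        obtain m n :: int where mn: "h x = 2 * pi * of_int m" "h y = 2 * pi * of_int n"
          using h_int x y by meson
        hence "n \<noteq> m" using y by auto
        hence "1 \<le> \<bar>real_of_int (n - m)\<bar>" by linarith
        hence "2 * pi * 1 \<le> 2 * pi * \<bar>real_of_int (n - m)\<bar>" by (intro mult_left_mono) auto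
        also have "\<dots> = norm (h y - h x)" unfolding mn by (simp add: abs_mult flip: right_diff_distrib)
        finally show "2 * pi \<le> norm (h y - h x)" by simp
      qed auto
    qed auto
    hence "h 1 = h 0" unfolding constant_on_def by (metis atLeastAtMost_iff order_refl zero_le_one)
    thus ?thesis using \<psi>(2) by (simp add: h_def \<phi>_def)
  qed
  have "cont_arg f g a = \<phi> 1"
    unfolding cont_arg_def
  proof (rule the_equality)
    show "\<exists>\<psi>. continuous_on {0..1} \<psi> \<and> \<psi> 0 = a \<and> (\<forall>t\<in>{0..1}. is_Arg (f (g t)) (\<psi> t)) \<and> \<psi> 1 = \<phi> 1"
      using cont arg by (intro exI[of _ \<phi>]) (auto simp: \<phi>_def)
  qed (use uniq in auto)
  also have "\<phi> 1 = a + Im (pathfinish q - pathstart q)"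
    by (simp add: \<phi>_def pathfinish_def pathstart_def)
  also have "\<dots> = a + Im (contour_integral g (\<lambda>z. deriv f z / f z))"
    by (simp only: q(2) wn)
  finally show ?thesis .
qed

lemma is_Arg_of_nonneg_real: "r \<ge> 0 \<Longrightarrow> is_Arg (of_real r) 0"
  by (simp add: is_Arg_def)

text \<open>
Together with the next lemma this transports integrals along line segments through the symmetries
of $\xi$.
\<close>

lemma contour_integral_linepath_cnj:
  assumes "\<And>z. F (cnj z) = cnj (F z)"
  shows "contour_integral (linepath (cnj a) (cnj b)) F = cnj (contour_integral (linepath a b) F)"
proof -
  have "linepath (cnj a) (cnj b) x = cnj (linepath a b x)" for x
    by (simp add: linepath_def)
  thus ?thesis
    by (simp add: contour_integral_integral Henstock_Kurzweil_Integration.integral_cnj assms)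
qed

lemma contour_integral_linepath_reflect:
  assumes "\<And>z. F (1 - z) = - F z"
  shows "contour_integral (linepath (1 - a) (1 - b)) F = contour_integral (linepath a b) F"
proof -
  have *: "linepath (1 - a) (1 - b) x = 1 - linepath a b x" for x
    by (simp add: linepath_def algebra_simps)
  show ?thesis
    unfolding contour_integral_integral vector_derivative_linepath_at * assms
    by (simp add: algebra_simps)
qed

section \<open>Counting the zeros of xi\<close>

definition xi_logderiv :: "complex \<Rightarrow> complex" where
  "xi_logderiv z = deriv xi_entire z / xi_entire z"

lemma xi_entire_has_deriv: "(xi_entire has_field_derivative deriv xi_entire z) (at z)"
  using xi_entire_holomorphic[of UNIV] by (intro holomorphic_derivI[where S = UNIV]) auto

lemma xi_logderiv_reflect: "xi_logderiv (1 - z) = - xi_logderiv z"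
proof -
  have "((\<lambda>w. xi_entire (1 - w)) has_field_derivative deriv xi_entire (1 - z) * (0 - 1)) (at z)"
    by (rule DERIV_chain'[where g = xi_entire, OF _ xi_entire_has_deriv]) (auto intro!: derivative_eq_intros)
  hence "(xi_entire has_field_derivative - deriv xi_entire (1 - z)) (at z)" by (simp add: xi_entire_reflect)
  hence "deriv xi_entire z = - deriv xi_entire (1 - z)" by (rule DERIV_imp_deriv)
  thus ?thesis by (simp add: xi_logderiv_def xi_entire_reflect)
qed

lemma xi_logderiv_cnj: "xi_logderiv (cnj z) = cnj (xi_logderiv z)"
proof -
  have "((cnj \<circ> xi_entire \<circ> cnj) has_field_derivative cnj (deriv xi_entire (cnj z))) (at z)"
    by (rule has_field_derivative_cnj_cnj[OF xi_entire_has_deriv])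
  moreover have "cnj \<circ> xi_entire \<circ> cnj = xi_entire" by (auto simp: xi_entire_cnj)
  ultimately have "deriv xi_entire z = cnj (deriv xi_entire (cnj z))" by (simp add: DERIV_imp_deriv)
  hence "deriv xi_entire (cnj z) = cnj (deriv xi_entire z)" by simp
  thus ?thesis by (simp add: xi_logderiv_def xi_entire_cnj)
qed

text \<open>
The two lines that carry the path: $\zeta$ has no zeros on the first by convergence and none on the
second by the choice of \<open>T\<close>.
\<close>

lemma path_image_L2:
  assumes "T > 0" "z \<in> path_image (L2 T)"
  shows "Re z = 2 \<or> (Im z = T \<and> 1 / 2 \<le> Re z \<and> Re z \<le> 2)"
proof -
  have "z \<in> closed_segment 2 (Complex 2 T) \<or> z \<in> closed_segment (Complex 2 T) (Complex (1/2) T)"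
    using assms(2) by (auto simp: L2_def path_image_join)
  thus ?thesis
    by (auto simp: closed_segment_same_Re closed_segment_same_Im closed_segment_eq_real_ivl split: if_splits)
qed

lemma L2_paths [simp]:
  "valid_path (L2 T)" "pathstart (L2 T) = 2" "pathfinish (L2 T) = Complex (1/2) T"
  by (auto simp: L2_def valid_path_join)

lemma completed_factor_holomorphic: "completed_factor holomorphic_on {s. Re s > 0}"
  unfolding completed_factor_def[abs_def]
  using half_notin_nonpos_Ints by (intro holomorphic_intros) auto

text \<open>
A height at which the upper side of the rectangle avoids the zeros.
\<close>

locale zero_free_height =
  fixes T :: real
  assumes T_pos: "T > 0"
    and zeta_nz: "\<And>\<sigma>. -1 \<le> \<sigma> \<Longrightarrow> \<sigma> \<le> 2 \<Longrightarrow> zeta (Complex \<sigma> T) \<noteq> 0"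
begin

lemma xi_nonzero_at_height:
  assumes "Im z = T" "-1 \<le> Re z" "Re z \<le> 2"
  shows "xi_entire z \<noteq> 0"
proof -
  have 1: "z / 2 \<notin> \<int>\<^sub>\<le>\<^sub>0" using T_pos assms(1) by (auto elim!: nonpos_Ints_cases simp: complex_eq_iff)
  have 2: "z \<noteq> 1" "z \<noteq> 0" using T_pos assms(1) by auto
  have "zeta z \<noteq> 0" using zeta_nz[of "Re z"] assms by (metis complex_surj)
  thus ?thesis unfolding xi_formula[OF 1 2(1)] using 2 completed_factor_nonzero[OF 1] by simp
qed

text \<open>
The left side is the mirror image of the right side under $s \mapsto 1 - s$, and the lower side is real.
\<close>

lemma xi_nonzero_on_boundary:
  assumes "(Re z = -1 \<or> Re z = 2) \<or> (Im z = 0 \<or> Im z = T) \<and> -1 \<le> Re z \<and> Re z \<le> 2"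
  shows "xi_entire z \<noteq> 0"
proof -
  consider "Re z = -1" | "Re z = 2" | "Im z = 0" | "Im z = T" "-1 \<le> Re z" "Re z \<le> 2" using assms by auto
  thus ?thesis
  proof cases
    case 1
    hence "xi_entire (1 - z) \<noteq> 0" by (intro xi_nonzero_on_line_2) simp
    thus ?thesis by (simp add: xi_entire_reflect)
  next
    case 3
    hence "z = of_real (Re z)" by (simp add: complex_eq_iff)
    thus ?thesis using xi_entire_real_pos[of "Re z"] by force
  qed (use xi_nonzero_at_height xi_nonzero_on_line_2 in auto)
qed

text \<open>
The argument principle is applied on an open rectangle that is slightly larger: its zeros lie in a
compact set and are therefore finite in number, and those outside the closed rectangle have winding
number $0$.
\<close>

lemma zeros_by_contour_integral:
  "finite (zeros_in_rect T)"
  "contour_integral (rectpath (-1) (Complex 2 T)) xi_logderiv = 2 * pi * \<i> * of_int (N T)"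
proof -
  define S where "S = box (Complex (-2) (-1)) (Complex 3 (T + 1))"
  define R where "R = cbox (-1) (Complex 2 T)"
  have Z: "zeros_in_rect T = {z \<in> R. xi_entire z = 0}"
    by (auto simp: zeros_in_rect_def R_def in_cbox_complex_iff xi_eq)
  have R_sub: "R \<subseteq> S" by (auto simp: R_def S_def in_cbox_complex_iff in_box_complex_iff)
  have not_const: "\<not> xi_entire constant_on UNIV"
  proof
    assume "xi_entire constant_on UNIV"
    hence "xi_entire 2 = xi_entire 1" by (auto simp: constant_on_def)
    hence "complex_of_real (pi / 6) = of_real (1 / 2)" unfolding xi_entire_2 xi_entire_1 by simp
    hence "pi / 6 = 1 / 2" by (simp only: of_real_eq_iff)
    thus False using pi_gt3 by simp
  qed
  have fin: "finite {z \<in> cbox (Complex (-2) (-1)) (Complex 3 (T + 1)). xi_entire z = 0}"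
    by (rule holomorphic_compact_finite_zeros[where S = UNIV])
       (use not_const in \<open>auto intro: xi_entire_holomorphic\<close>)
  have finS: "finite {z \<in> S. xi_entire z = 0}"
    by (rule finite_subset[OF _ fin]) (use box_subset_cbox in \<open>auto simp: S_def\<close>)
  thus "finite (zeros_in_rect T)" unfolding Z by (rule rev_finite_subset) (use R_sub in auto)
  have bdry: "z \<in> box (-1) (Complex 2 T)" if "z \<in> R" "xi_entire z = 0" for z
    using that xi_nonzero_on_boundary[of z]
    by (auto simp: R_def in_cbox_complex_iff in_box_complex_iff less_le)
  have path_sub: "path_image (rectpath (-1) (Complex 2 T)) \<subseteq> S - {z \<in> S. xi_entire z = 0 \<or> z \<in> {}}"
  proof -
    have "path_image (rectpath (-1) (Complex 2 T)) = R - box (-1) (Complex 2 T)"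
      unfolding R_def using T_pos by (intro path_image_rectpath_cbox_minus_box) auto
    thus ?thesis using R_sub bdry by auto
  qed
  have wn1: "winding_number (rectpath (-1) (Complex 2 T)) z = 1" if "z \<in> zeros_in_rect T" for z
    using that bdry unfolding Z by (intro winding_number_rectpath) auto
  have wn0: "winding_number (rectpath (-1) (Complex 2 T)) z = 0" if "z \<notin> R" for z
    using that T_pos unfolding R_def by (intro winding_number_rectpath_outside) auto
  have "contour_integral (rectpath (-1) (Complex 2 T)) (\<lambda>x. deriv xi_entire x * 1 / xi_entire x) =
      2 * pi * \<i> * (\<Sum>p\<in>{w \<in> S. xi_entire w = 0 \<or> w \<in> {}}. winding_number (rectpath (-1) (Complex 2 T)) p * 1 * zorder xi_entire p)"
  proof (rule argument_principle)
    show "open S" "connected S" by (auto simp: S_def convex_connected)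
    show "\<forall>z. z \<notin> S \<longrightarrow> winding_number (rectpath (-1) (Complex 2 T)) z = 0" using wn0 R_sub by blast
  qed (use finS path_sub in \<open>auto intro: xi_entire_holomorphic\<close>)
  also have "(\<Sum>p\<in>{w \<in> S. xi_entire w = 0 \<or> w \<in> {}}. winding_number (rectpath (-1) (Complex 2 T)) p * 1 * zorder xi_entire p)
     = (\<Sum>p\<in>zeros_in_rect T. of_int (zorder xi_entire p))"
  proof (rule sum.mono_neutral_cong_right)
    show "zeros_in_rect T \<subseteq> {w \<in> S. xi_entire w = 0 \<or> w \<in> {}}" unfolding Z using R_sub by auto
    show "\<forall>p\<in>{w \<in> S. xi_entire w = 0 \<or> w \<in> {}} - zeros_in_rect T.
        winding_number (rectpath (-1) (Complex 2 T)) p * 1 * zorder xi_entire p = 0"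
      using wn0 unfolding Z by auto
  qed (use finS wn1 in auto)
  also have "\<dots> = of_int (N T)" by (simp add: N_def xi_eq)
  finally show "contour_integral (rectpath (-1) (Complex 2 T)) xi_logderiv = 2 * pi * \<i> * of_int (N T)"
    by (simp add: xi_logderiv_def[abs_def])
qed

lemma xi_logderiv_continuous:
  assumes "\<And>z. z \<in> A \<Longrightarrow> xi_entire z \<noteq> 0"
  shows "continuous_on A xi_logderiv"
  unfolding xi_logderiv_def[abs_def] using assms
  by (intro continuous_intros holomorphic_on_imp_continuous_on xi_entire_holomorphic
        holomorphic_on_subset[OF holomorphic_deriv[OF xi_entire_holomorphic open_UNIV]]) auto

text \<open>
The logarithmic derivative $F$ of $\xi$ satisfies $F(1 - \bar z) = -\overline{F(z)}$. The reflection
$z \mapsto 1 - \bar z$ maps the right half of the upper part of the boundary to its left half and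
reverses the orientation, so the integrals over the two halves have equal imaginary parts. The integral over
the lower side is real.
\<close>

lemma zeros_by_half_contour:
  "pi * of_int (N T) = Im (contour_integral (L2 T) xi_logderiv)"
proof -
  define m where "m = Complex (1/2) T"
  let ?I = "\<lambda>a b. contour_integral (linepath a b) xi_logderiv"
  have seg: "continuous_on (closed_segment a b) xi_logderiv"
    if "(Re a = -1 \<and> Re b = -1) \<or> (Re a = 2 \<and> Re b = 2) \<or> (Im a = 0 \<and> Im b = 0 \<or> Im a = T \<and> Im b = T) \<and>
         -1 \<le> Re a \<and> Re a \<le> 2 \<and> -1 \<le> Re b \<and> Re b \<le> 2" for a b
  proof (rule xi_logderiv_continuous, rule xi_nonzero_on_boundary)
    fix z assume "z \<in> closed_segment a b"
    thus "(Re z = -1 \<or> Re z = 2) \<or> (Im z = 0 \<or> Im z = T) \<and> -1 \<le> Re z \<and> Re z \<le> 2"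
      using that by (auto simp: closed_segment_same_Re closed_segment_same_Im closed_segment_eq_real_ivl split: if_splits)
  qed
  note int = contour_integrable_continuous_linepath[OF seg]
  have rect: "contour_integral (rectpath (-1) (Complex 2 T)) xi_logderiv =
      ?I (-1) 2 + ?I 2 (Complex 2 T) + ?I (Complex 2 T) (Complex (-1) T) + ?I (Complex (-1) T) (-1)"
  proof -
    have [simp]: "Complex 2 0 = 2" by (simp add: complex_eq_iff)
    show ?thesis
      by (simp add: rectpath_def Let_def int contour_integrable_joinI valid_path_join add.assoc)
  qed
  have top: "?I (Complex 2 T) (Complex (-1) T) = ?I (Complex 2 T) m + ?I m (Complex (-1) T)"
  proof (rule contour_integral_split_linepath)
    show "continuous_on (closed_segment (Complex 2 T) (Complex (-1) T)) xi_logderiv" by (rule seg) auto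
    show "m \<in> closed_segment (Complex 2 T) (Complex (-1) T)"
      by (auto simp: m_def closed_segment_same_Im closed_segment_eq_real_ivl)
  qed
  have L2: "contour_integral (L2 T) xi_logderiv = ?I 2 (Complex 2 T) + ?I (Complex 2 T) m"
    unfolding L2_def m_def by (subst contour_integral_join) (auto intro!: int)
  have bottom: "Im (?I (-1) 2) = 0"
  proof -
    have "?I (cnj (-1)) (cnj 2) = cnj (?I (-1) 2)"
      by (rule contour_integral_linepath_cnj[where F = xi_logderiv, OF xi_logderiv_cnj])
    hence "Im (?I (-1) 2) = Im (cnj (?I (-1) 2))" by simp
    thus ?thesis by simp
  qed
  have mirror: "?I (1 - cnj a) (1 - cnj b) = cnj (?I a b)" for a b
    using contour_integral_linepath_reflect[where F = xi_logderiv, OF xi_logderiv_reflect, of "cnj a" "cnj b"]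
      contour_integral_linepath_cnj[where F = xi_logderiv, OF xi_logderiv_cnj, of a b] by simp
  have top_left: "Im (?I m (Complex (-1) T)) = Im (?I (Complex 2 T) m)"
  proof -
    have "1 - cnj m = m" "1 - cnj (Complex 2 T) = Complex (-1) T" by (auto simp: m_def complex_eq_iff)
    hence "?I m (Complex (-1) T) = cnj (?I m (Complex 2 T))" using mirror[of m "Complex 2 T"] by simp
    also have "?I m (Complex 2 T) = - ?I (Complex 2 T) m"
      by (intro contour_integral_reverse_linepath seg) (auto simp: m_def)
    finally show ?thesis by simp
  qed
  have left: "Im (?I (Complex (-1) T) (-1)) = Im (?I 2 (Complex 2 T))"
  proof -
    have "1 - cnj 2 = -1" "1 - cnj (Complex 2 T) = Complex (-1) T" by (auto simp: complex_eq_iff)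
    hence "?I (Complex (-1) T) (-1) = cnj (?I (Complex 2 T) 2)" using mirror[of "Complex 2 T" 2] by simp
    also have "?I (Complex 2 T) 2 = - ?I 2 (Complex 2 T)"
      by (intro contour_integral_reverse_linepath seg) auto
    finally show ?thesis by simp
  qed
  have "2 * pi * of_int (N T) = Im (contour_integral (rectpath (-1) (Complex 2 T)) xi_logderiv)"
    by (simp add: zeros_by_contour_integral(2))
  also have "\<dots> = 2 * Im (contour_integral (L2 T) xi_logderiv)"
    by (simp add: rect top L2 bottom top_left left)
  finally show ?thesis by simp
qed

text \<open>
Principal logarithms serve as primitives, because neither $z$ nor $z - 1$ meets the closed negative
real axis on the path. At the end point the two numbers are mirror images in the imaginary axis, so
their arguments add up to $\pi$.
\<close>

lemma contour_integral_log_factors: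
  "((\<lambda>z. 1 / z + 1 / (z - 1)) has_contour_integral
     (Ln (Complex (1/2) T) + Ln (Complex (1/2) T - 1) - Ln 2)) (L2 T)"
  "Im (Ln (Complex (1/2) T) + Ln (Complex (1/2) T - 1) - Ln 2) = pi"
proof -
  have "((\<lambda>z. 1 / z + 1 / (z - 1)) has_contour_integral
     ((Ln (pathfinish (L2 T)) + Ln (pathfinish (L2 T) - 1)) - (Ln (pathstart (L2 T)) + Ln (pathstart (L2 T) - 1)))) (L2 T)"
  proof (rule contour_integral_primitive[where S = "path_image (L2 T)"])
    fix z assume "z \<in> path_image (L2 T)"
    hence "z \<notin> \<real>\<^sub>\<le>\<^sub>0" "z - 1 \<notin> \<real>\<^sub>\<le>\<^sub>0"
      using path_image_L2[OF T_pos] T_pos by (force simp: complex_nonpos_Reals_iff)+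
    thus "((\<lambda>z. Ln z + Ln (z - 1)) has_field_derivative 1 / z + 1 / (z - 1)) (at z within path_image (L2 T))"
      by (auto intro!: derivative_eq_intros simp: field_simps)
  qed auto
  thus "((\<lambda>z. 1 / z + 1 / (z - 1)) has_contour_integral
     (Ln (Complex (1/2) T) + Ln (Complex (1/2) T - 1) - Ln 2)) (L2 T)" by simp
  define m where "m = Complex (1/2) T"
  have m: "m \<notin> \<real>\<^sub>\<le>\<^sub>0" "m \<noteq> 0" "m - 1 = - cnj m" "Im (cnj m) < 0"
    using T_pos by (auto simp: m_def complex_nonpos_Reals_iff complex_eq_iff)
  have "Ln (- cnj m) = Ln (cnj m) + \<i> * pi"
    using m(2,4) by (subst Ln_minus) auto
  hence "Ln (m - 1) = cnj (Ln m) + \<i> * pi" using m(3) cnj_Ln[OF m(1)] by simp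
  moreover have "Im (Ln 2) = 0" using Ln_of_real[of 2] by simp
  ultimately show "Im (Ln (Complex (1/2) T) + Ln (Complex (1/2) T - 1) - Ln 2) = pi"
    by (simp flip: m_def)
qed

lemma xi_logderiv_split:
  assumes "z \<in> path_image (L2 T)"
  shows "xi_logderiv z = (1 / z + 1 / (z - 1)) + deriv completed_factor z / completed_factor z + deriv zeta z / zeta z"
proof -
  define V where "V = {s. Re s > 0} - {1 :: complex}"
  have V: "open V" unfolding V_def by (intro open_Diff open_halfspace_Re_gt) auto
  have z: "Re z > 0" "z \<noteq> 1" "z \<noteq> 0" using path_image_L2[OF T_pos assms] T_pos by auto
  hence "z \<in> V" by (simp add: V_def)
  have c: "completed_factor z \<noteq> 0" using z half_notin_nonpos_Ints completed_factor_nonzero by auto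
  have xz: "xi_entire z \<noteq> 0" using path_image_L2[OF T_pos assms] by (intro xi_nonzero_on_boundary) auto
  have f: "xi_entire w = w / 2 * (w - 1) * completed_factor w * zeta w" if "w \<in> V" for w
    using that half_notin_nonpos_Ints unfolding V_def by (intro xi_formula) auto
  have zz: "zeta z \<noteq> 0" using xz f[OF \<open>z \<in> V\<close>] by auto
  have dc: "(completed_factor has_field_derivative deriv completed_factor z) (at z)"
    using completed_factor_holomorphic z by (intro holomorphic_derivI[where S = "{s. Re s > 0}"]) (auto simp: open_halfspace_Re_gt)
  have dz: "(zeta has_field_derivative deriv zeta z) (at z)"
    using zeta_continued_holomorphic z unfolding zeta_eq by (intro holomorphic_derivI[where S = "- {1}"]) auto
  define D where "D = ((1 / 2 * (z - 1) + z / 2 * 1) * completed_factor z + z / 2 * (z - 1) * deriv completed_factor z) * zeta z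
     + z / 2 * (z - 1) * completed_factor z * deriv zeta z"
  have "((\<lambda>w. w / 2 * (w - 1) * completed_factor w * zeta w) has_field_derivative D) (at z)"
    unfolding D_def by (rule derivative_eq_intros dc dz refl | simp add: algebra_simps)+
  hence "(xi_entire has_field_derivative D) (at z)"
    by (rule has_field_derivative_transform_within_open[OF _ V \<open>z \<in> V\<close>]) (simp add: f)
  hence deriv: "deriv xi_entire z = D" by (rule DERIV_imp_deriv)
  have "D / (z / 2 * (z - 1) * completed_factor z * zeta z) =
      (1 / z + 1 / (z - 1)) + deriv completed_factor z / completed_factor z + deriv zeta z / zeta z"
    using z(2,3) c zz unfolding D_def by (simp add: divide_simps)
  thus ?thesis unfolding xi_logderiv_def deriv f[OF \<open>z \<in> V\<close>] .
qed

text \<open>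
Both arguments start from $0$ because $\pi^{-s/2}\Gamma(s/2)$ and $\zeta(s)$ are positive at $s = 2$.
\<close>

lemma contour_integral_L2:
  "Im (contour_integral (L2 T) xi_logderiv) = theta T + arg_zeta T + pi"
proof -
  define V where "V = {s. Re s > 0} - {1 :: complex}"
  have V: "open V" unfolding V_def by (intro open_Diff open_halfspace_Re_gt) auto
  have L2V: "path_image (L2 T) \<subseteq> V"
    using path_image_L2[OF T_pos] T_pos unfolding V_def by fastforce
  have hol: "completed_factor holomorphic_on V" "zeta holomorphic_on V"
    unfolding zeta_eq
    by (rule holomorphic_on_subset[OF completed_factor_holomorphic], force simp: V_def,
        rule holomorphic_on_subset[OF zeta_continued_holomorphic], force simp: V_def)
  have nz: "completed_factor z \<noteq> 0" "zeta z \<noteq> 0" if "z \<in> path_image (L2 T)" for z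
  proof -
    have "Re z > 0" using L2V that by (auto simp: V_def)
    thus "completed_factor z \<noteq> 0" using half_notin_nonpos_Ints completed_factor_nonzero by auto
    show "zeta z \<noteq> 0"
      using path_image_L2[OF T_pos that] zeta_nonzero_on_line_2[of z] zeta_nz[of "Re z"]
      by (metis complex_surj order_trans zero_le_one neg_le_0_iff_le divide_nonneg_pos zero_less_numeral)
  qed
  have int: "(\<lambda>z. deriv f z / f z) contour_integrable_on (L2 T)"
    if "f holomorphic_on V" "\<And>z. z \<in> path_image (L2 T) \<Longrightarrow> f z \<noteq> 0" for f
  proof (rule contour_integrable_holomorphic_simple)
    have "continuous_on V f" using that(1) by (rule holomorphic_on_imp_continuous_on)
    thus "open (V \<inter> f -` (- {0}))" using V by (intro continuous_open_preimage) auto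
    show "(\<lambda>z. deriv f z / f z) holomorphic_on V \<inter> f -` (- {0})"
      by (intro holomorphic_intros holomorphic_on_subset[OF that(1)]
            holomorphic_on_subset[OF holomorphic_deriv[OF that(1) V]]) auto
  qed (use L2V that(2) in auto)
  have "completed_factor = (\<lambda>s. of_real pi powr (- s / 2) * Gamma (s / 2))"
    by (auto simp: completed_factor_def)
  hence "theta T = cont_arg completed_factor (L2 T) 0" by (simp add: theta_def)
  also have "\<dots> = 0 + Im (contour_integral (L2 T) (\<lambda>z. deriv completed_factor z / completed_factor z))"
    by (rule cont_arg_eq_contour_integral[OF V hol(1)])
       (use L2V nz in \<open>auto simp: completed_factor_2 simp del: of_real_divide intro!: is_Arg_of_nonneg_real\<close>)
  finally have th: "Im (contour_integral (L2 T) (\<lambda>z. deriv completed_factor z / completed_factor z)) = theta T" by simp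
  have "arg_zeta T = 0 + Im (contour_integral (L2 T) (\<lambda>z. deriv zeta z / zeta z))"
    unfolding arg_zeta_def
    by (rule cont_arg_eq_contour_integral[OF V hol(2)])
       (use L2V nz in \<open>auto simp: zeta_2 simp del: of_real_divide of_real_power intro!: is_Arg_of_nonneg_real\<close>)
  hence az: "Im (contour_integral (L2 T) (\<lambda>z. deriv zeta z / zeta z)) = arg_zeta T" by simp
  note log = contour_integral_log_factors
  have "contour_integral (L2 T) xi_logderiv =
      contour_integral (L2 T) (\<lambda>z. (1 / z + 1 / (z - 1)) + deriv completed_factor z / completed_factor z + deriv zeta z / zeta z)"
    by (rule contour_integral_cong) (auto simp: xi_logderiv_split)
  also have "\<dots> = contour_integral (L2 T) (\<lambda>z. 1 / z + 1 / (z - 1))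
      + contour_integral (L2 T) (\<lambda>z. deriv completed_factor z / completed_factor z)
      + contour_integral (L2 T) (\<lambda>z. deriv zeta z / zeta z)"
    using has_contour_integral_integrable[OF log(1)] int[OF hol(1) nz(1)] int[OF hol(2) nz(2)]
    by (simp only: contour_integral_add contour_integrable_add)
  finally show ?thesis
    using contour_integral_unique[OF log(1)] log(2) th az by (simp only: plus_complex.simps)
qed

end

theorem theorem2:
  fixes T :: real
  assumes "T > 0"
    and "\<forall>\<sigma>::real. -1 \<le> \<sigma> \<and> \<sigma> \<le> 2 \<longrightarrow> zeta (Complex \<sigma> T) \<noteq> 0"
  shows "finite (zeros_in_rect T) \<and>
         real_of_int (N T) = (theta T + arg_zeta T) / pi + 1"
proof -
  interpret zero_free_height T using assms by unfold_locales auto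
  have "pi * real_of_int (N T) = theta T + arg_zeta T + pi"
    by (simp only: zeros_by_half_contour contour_integral_L2)
  hence "real_of_int (N T) = (theta T + arg_zeta T) / pi + 1" by (simp add: field_simps)
  with zeros_by_contour_integral(1) show ?thesis by simp
qed

end
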